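(* Let $\widehat\Phi\colon\mathbb{T}^2\to F_2(\mathbb{T}^2)$ be a lift of a split $2$-valued map $\phi\colon\mathbb{T}^2\multimap\mathbb{T}^2$ that satisfies $\widehat\Phi_{\#}(e_1)=(w^r,(a,b))$ and $\widehat\Phi_{\#}(e_2)=(w^s,(c,d))$, where $w\in\mathbb{F}_2(u,v)$, $a,b,c,d\in\mathbb{Z}$ and $(r,s)\in\mathbb{Z}^2\setminus\{(0,0)\}$ satisfy $s(a-1,b)=r(c,d-1)$. Then $\phi$ may be deformed to a fixed point free $2$-valued map.
   Context: A $2$-valued map $\phi\colon X\multimap Y$ assigns to each $x\in X$ a subset $\phi(x)\subset Y$ of exactly two points, and is continuous: for every open $V\subset Y$ the sets $\{x\mid\phi(x)\subset V\}$ and $\{x\mid\phi(x)\cap V\neq\varnothing\}$ are open and each $\phi(x)$ is closed. It is split if $\phi(x)=\{f_1(x),f_2(x)\}$ for continuous maps $f_1,f_2\colon X\to Y$. A deformation (homotopy) of $2$-valued maps is a $2$-valued map $H\colon X\times I\multimap Y$ with the prescribed ends. $\phi\colon X\multimap X$ is fixed point free if $x\notin\phi(x)$ for all $x$. $F_2(\mathbb{T}^2)=\{(y_1,y_2)\in\mathbb{T}^2\times\mathbb{T}^2\mid y_1\neq y_2\}$; a lift of a split map $\phi=\{f_1,f_2\}$ is a map $\widehat\Phi=(f_1,f_2)\colon\mathbb{T}^2\to F_2(\mathbb{T}^2)$. $(e_1,e_2)$ is the basis of $\pi_1(\mathbb{T}^2)\cong\mathbb{Z}^2$ given by the meridian and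 longitude. $P_2(\mathbb{T}^2)=\pi_1(F_2(\mathbb{T}^2))$ is identified with $\mathbb{F}_2(u,v)\times\mathbb{Z}^2$ as follows. Let $p_i\colon F_2(\mathbb{T}^2)\to\mathbb{T}^2$ be the $i$-th projection. $\mathbb{F}_2(u,v)$ is the kernel of $p_{2\#}$, i.e. $\pi_1(\mathbb{T}^2\setminus\{x_2\},x_1)$, which is free on $u,v$, where $p_{1\#}(u)=e_1$, $p_{1\#}(v)=e_2$; the factor $\mathbb{Z}^2$ is the centre of $P_2(\mathbb{T}^2)$, with basis $x,y$ satisfying $p_{i\#}(x)=e_1$, $p_{i\#}(y)=e_2$ for $i=1,2$ (both points moving together along the meridian, resp. the longitude). The element $wx^ay^b$ is written $(w,(a,b))$. Basepoints are suppressed (fundamental groups at different basepoints being identified via paths). *)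

theory Defs
  imports "HOL-Analysis.Analysis" "HOL-Algebra.Coset"
begin

section \<open>Two-valued maps\<close>

definition two_valued_map ::
  "'a::topological_space set \<Rightarrow> 'b::topological_space set \<Rightarrow> ('a \<Rightarrow> 'b set) \<Rightarrow> bool" where
  "two_valued_map X Y \<phi> \<longleftrightarrow>
     (\<forall>x\<in>X. \<phi> x \<subseteq> Y \<and> card (\<phi> x) = 2) \<and>
     (\<forall>x\<in>X. closedin (top_of_set Y) (\<phi> x)) \<and>
     (\<forall>V. openin (top_of_set Y) V \<longrightarrow>
        openin (top_of_set X) {x \<in> X. \<phi> x \<subseteq> V} \<and>
        openin (top_of_set X) {x \<in> X. \<phi> x \<inter> V \<noteq> {}})"

definition split_map ::
  "'a::topological_space set \<Rightarrow> 'b::topological_space set \<Rightarrow> ('a \<Rightarrow> 'b set) \<Rightarrow> bool" where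
  "split_map X Y \<phi> \<longleftrightarrow>
     (\<exists>f1 f2. continuous_on X f1 \<and> f1 \<in> X \<rightarrow> Y \<and> continuous_on X f2 \<and> f2 \<in> X \<rightarrow> Y \<and>
        (\<forall>x\<in>X. \<phi> x = {f1 x, f2 x}))"

definition deformable ::
  "'a::topological_space set \<Rightarrow> 'b::topological_space set \<Rightarrow>
   ('a \<Rightarrow> 'b set) \<Rightarrow> ('a \<Rightarrow> 'b set) \<Rightarrow> bool" where
  "deformable X Y \<phi> \<psi> \<longleftrightarrow>
     (\<exists>H :: 'a \<times> real \<Rightarrow> 'b set. two_valued_map (X \<times> {0..1}) Y H \<and>
        (\<forall>x\<in>X. H (x, 0) = \<phi> x \<and> H (x, 1) = \<psi> x))"

definition fixed_point_free :: "'a set \<Rightarrow> ('a \<Rightarrow> 'a set) \<Rightarrow> bool" where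
  "fixed_point_free X \<phi> \<longleftrightarrow> (\<forall>x\<in>X. x \<notin> \<phi> x)"

definition conf2 :: "'a set \<Rightarrow> ('a \<times> 'a) set" where
  "conf2 Y = {(y1, y2). y1 \<in> Y \<and> y2 \<in> Y \<and> y1 \<noteq> y2}"

definition is_lift ::
  "'a::topological_space set \<Rightarrow> 'b::topological_space set \<Rightarrow>
   ('a \<Rightarrow> 'b set) \<Rightarrow> ('a \<Rightarrow> 'b \<times> 'b) \<Rightarrow> bool" where
  "is_lift X Y \<phi> \<Phi> \<longleftrightarrow>
     continuous_on X \<Phi> \<and> \<Phi> \<in> X \<rightarrow> conf2 Y \<and> (\<forall>x\<in>X. \<phi> x = {fst (\<Phi> x), snd (\<Phi> x)})"


section \<open>The fundamental group\<close>

definition path_class :: "'a::topological_space set \<Rightarrow> (real \<Rightarrow> 'a) \<Rightarrow> (real \<Rightarrow> 'a) set" where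
  "path_class S p = {q. homotopic_paths S p q}"

definition loops_at :: "'a::topological_space set \<Rightarrow> 'a \<Rightarrow> (real \<Rightarrow> 'a) set" where
  "loops_at S x = {p. path p \<and> path_image p \<subseteq> S \<and> pathstart p = x \<and> pathfinish p = x}"

definition pi1 :: "'a::topological_space set \<Rightarrow> 'a \<Rightarrow> (real \<Rightarrow> 'a) set monoid" where
  "pi1 S x =
     \<lparr>carrier = path_class S ` loops_at S x,
      mult = (\<lambda>A B. \<Union>p\<in>A. \<Union>q\<in>B. path_class S (p +++ q)),
      one = path_class S (\<lambda>_. x)\<rparr>"

text \<open>The homomorphism induced by a continuous map with values in \<open>T\<close>; the base points
  are those of the loops it is applied to.\<close>

definition pi1_map ::
  "'b::topological_space set \<Rightarrow> ('a \<Rightarrow> 'b) \<Rightarrow> (real \<Rightarrow> 'a) set \<Rightarrow> (real \<Rightarrow> 'b) set" where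
  "pi1_map T f A = (\<Union>p\<in>A. path_class T (f \<circ> p))"

lemma path_class_eq:
  "homotopic_paths S p q \<Longrightarrow> path_class S p = path_class S q"
  unfolding path_class_def by (blast intro: homotopic_paths_sym homotopic_paths_trans)

lemma path_class_eq_iff:
  assumes "p \<in> loops_at S x"
  shows "path_class S p = path_class S q \<longleftrightarrow> homotopic_paths S p q"
proof
  assume "path_class S p = path_class S q"
  moreover have "p \<in> path_class S p"
    using assms by (simp add: path_class_def loops_at_def)
  ultimately show "homotopic_paths S p q"
    by (simp add: path_class_def homotopic_paths_sym)
qed (rule path_class_eq)

lemma loops_at_join: "\<lbrakk>p \<in> loops_at S x; q \<in> loops_at S x\<rbrakk> \<Longrightarrow> p +++ q \<in> loops_at S x"
  by (auto simp: loops_at_def path_image_join)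

lemma loops_at_reverse: "p \<in> loops_at S x \<Longrightarrow> reversepath p \<in> loops_at S x"
  by (auto simp: loops_at_def)

lemma loops_at_const: "x \<in> S \<Longrightarrow> (\<lambda>_. x) \<in> loops_at S x"
  by (auto simp: loops_at_def path_def path_image_def pathstart_def pathfinish_def)

lemma carrier_pi1: "carrier (pi1 S x) = path_class S ` loops_at S x"
  by (simp add: pi1_def)

lemma pi1_mult:
  assumes "p \<in> loops_at S x" "q \<in> loops_at S x"
  shows "path_class S p \<otimes>\<^bsub>pi1 S x\<^esub> path_class S q = path_class S (p +++ q)"
proof -
  have eq: "path_class S (p' +++ q') = path_class S (p +++ q)"
    if "p' \<in> path_class S p" "q' \<in> path_class S q" for p' q'
  proof -
    have "homotopic_paths S p p'" "homotopic_paths S q q'"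
      using that by (simp_all add: path_class_def)
    moreover have "pathfinish p = pathstart q"
      using assms by (simp add: loops_at_def)
    ultimately have "homotopic_paths S (p +++ q) (p' +++ q')"
      by (rule homotopic_paths_join)
    then show ?thesis
      by (rule path_class_eq[symmetric])
  qed
  have p: "p \<in> path_class S p" and q: "q \<in> path_class S q"
    using assms by (simp_all add: path_class_def loops_at_def)
  have "path_class S p \<otimes>\<^bsub>pi1 S x\<^esub> path_class S q =
      (\<Union>p'\<in>path_class S p. \<Union>q'\<in>path_class S q. path_class S (p' +++ q'))"
    by (simp add: pi1_def)
  also have "\<dots> = (\<Union>p'\<in>path_class S p. \<Union>q'\<in>path_class S q. path_class S (p +++ q))"
    by (intro SUP_cong refl eq)
  also have "\<dots> = path_class S (p +++ q)"
    using p q by blast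
  finally show ?thesis .
qed

lemma group_pi1:
  fixes S :: "'a::real_normed_vector set"
  assumes "x \<in> S"
  shows "group (pi1 S x)"
proof (rule groupI)
  have lin: "linepath x x = (\<lambda>_. x)"
    by (simp add: linepath_refl fun_eq_iff)
  note [simp] = pi1_mult loops_at_join
  have car: "carrier (pi1 S x) = path_class S ` loops_at S x"
    and one: "\<one>\<^bsub>pi1 S x\<^esub> = path_class S (\<lambda>_. x)"
    by (simp_all add: pi1_def)
  show "\<one>\<^bsub>pi1 S x\<^esub> \<in> carrier (pi1 S x)"
    using assms by (simp add: car one loops_at_const)
  show "A \<otimes>\<^bsub>pi1 S x\<^esub> B \<in> carrier (pi1 S x)"
    if "A \<in> carrier (pi1 S x)" "B \<in> carrier (pi1 S x)" for A B
    using that by (auto simp: car)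
  show "A \<otimes>\<^bsub>pi1 S x\<^esub> B \<otimes>\<^bsub>pi1 S x\<^esub> C = A \<otimes>\<^bsub>pi1 S x\<^esub> (B \<otimes>\<^bsub>pi1 S x\<^esub> C)"
    if ABC: "A \<in> carrier (pi1 S x)" "B \<in> carrier (pi1 S x)" "C \<in> carrier (pi1 S x)" for A B C
  proof -
    obtain p q r where pqr: "A = path_class S p" "B = path_class S q" "C = path_class S r"
      "p \<in> loops_at S x" "q \<in> loops_at S x" "r \<in> loops_at S x"
      using ABC by (auto simp: car)
    have "path_class S (p +++ (q +++ r)) = path_class S ((p +++ q) +++ r)"
      using pqr by (intro path_class_eq homotopic_paths_assoc) (auto simp: loops_at_def)
    then show ?thesis using pqr by simp
  qed
  show "\<one>\<^bsub>pi1 S x\<^esub> \<otimes>\<^bsub>pi1 S x\<^esub> A = A" if A: "A \<in> carrier (pi1 S x)" for A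
  proof -
    obtain p where p: "A = path_class S p" "p \<in> loops_at S x"
      using A by (auto simp: car)
    have "path_class S ((\<lambda>_. x) +++ p) = path_class S p"
      unfolding lin[symmetric] using p
      by (intro path_class_eq homotopic_paths_lid') (auto simp: loops_at_def)
    then show ?thesis using p assms by (simp add: one loops_at_const)
  qed
  show "\<exists>B\<in>carrier (pi1 S x). B \<otimes>\<^bsub>pi1 S x\<^esub> A = \<one>\<^bsub>pi1 S x\<^esub>"
    if A: "A \<in> carrier (pi1 S x)" for A
  proof -
    obtain p where p: "A = path_class S p" "p \<in> loops_at S x"
      using A by (auto simp: car)
    have "homotopic_paths S (reversepath p +++ p) (linepath x x)"
      using p homotopic_paths_linv[of p S] by (auto simp: loops_at_def)
    then have "path_class S (reversepath p +++ p) = \<one>\<^bsub>pi1 S x\<^esub>"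
      unfolding one lin by (rule path_class_eq)
    then have "path_class S (reversepath p) \<otimes>\<^bsub>pi1 S x\<^esub> A = \<one>\<^bsub>pi1 S x\<^esub>"
      using p by (simp add: loops_at_reverse)
    moreover have "path_class S (reversepath p) \<in> carrier (pi1 S x)"
      using p by (simp add: car loops_at_reverse)
    ultimately show ?thesis by blast
  qed
qed

lemma loops_at_compose:
  assumes "continuous_on S f" "f \<in> S \<rightarrow> T" "p \<in> loops_at S x"
  shows "f \<circ> p \<in> loops_at T (f x)"
proof -
  have p: "path p" "path_image p \<subseteq> S" "pathstart p = x" "pathfinish p = x"
    using assms(3) by (simp_all add: loops_at_def)
  have "path (f \<circ> p)"
    using p by (intro path_continuous_image continuous_on_subset[OF assms(1)])
  moreover have "path_image (f \<circ> p) \<subseteq> T"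
    using p(2) assms(2) by (auto simp: path_image_compose)
  ultimately show ?thesis
    using p by (simp add: loops_at_def pathstart_compose pathfinish_compose)
qed

lemma pi1_map_class:
  assumes "continuous_on S f" "f \<in> S \<rightarrow> T" "p \<in> loops_at S x"
  shows "pi1_map T f (path_class S p) = path_class T (f \<circ> p)"
proof -
  have eq: "path_class T (f \<circ> q) = path_class T (f \<circ> p)" if "q \<in> path_class S p" for q
  proof -
    have "homotopic_paths S p q"
      using that by (simp add: path_class_def)
    then have "homotopic_paths T (f \<circ> p) (f \<circ> q)"
      using assms(1,2) by (rule homotopic_paths_continuous_image)
    then show ?thesis
      by (rule path_class_eq[symmetric])
  qed
  have p: "p \<in> path_class S p"
    using assms by (simp add: path_class_def loops_at_def)
  have "pi1_map T f (path_class S p) = (\<Union>q\<in>path_class S p. path_class T (f \<circ> p))"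
    unfolding pi1_map_def by (intro SUP_cong refl eq)
  also have "\<dots> = path_class T (f \<circ> p)"
    using p by blast
  finally show ?thesis .
qed

lemma pi1_map_hom:
  assumes "continuous_on S f" "f \<in> S \<rightarrow> T"
  shows "pi1_map T f \<in> hom (pi1 S x) (pi1 T (f x))"
proof (rule homI)
  note simps = pi1_map_class[OF assms, of _ x] loops_at_compose[OF assms, of _ x]
  show "pi1_map T f A \<in> carrier (pi1 T (f x))" if "A \<in> carrier (pi1 S x)" for A
    using that by (auto simp: carrier_pi1 simps)
  show "pi1_map T f (A \<otimes>\<^bsub>pi1 S x\<^esub> B) = pi1_map T f A \<otimes>\<^bsub>pi1 T (f x)\<^esub> pi1_map T f B"
    if AB: "A \<in> carrier (pi1 S x)" "B \<in> carrier (pi1 S x)" for A B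
  proof -
    obtain p q where pq: "p \<in> loops_at S x" "q \<in> loops_at S x"
      and [simp]: "A = path_class S p" "B = path_class S q"
      using AB by (auto simp: carrier_pi1)
    have "pi1_map T f (path_class S (p +++ q)) = path_class T ((f \<circ> p) +++ (f \<circ> q))"
      using loops_at_join[OF pq] by (simp add: simps path_compose_join)
    then show ?thesis
      using pq by (simp add: pi1_mult simps)
  qed
qed


section \<open>The torus and its two-strand pure braid group\<close>

definition torus :: "(complex \<times> complex) set" where
  "torus = sphere 0 1 \<times> sphere 0 1"

definition meridian :: "complex \<times> complex \<Rightarrow> real \<Rightarrow> complex \<times> complex" where
  "meridian z t = (cis (2 * pi * t) * fst z, snd z)"

definition longitude :: "complex \<times> complex \<Rightarrow> real \<Rightarrow> complex \<times> complex" where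
  "longitude z t = (fst z, cis (2 * pi * t) * snd z)"

definition e1 :: "complex \<times> complex \<Rightarrow> (real \<Rightarrow> complex \<times> complex) set" where
  "e1 z = path_class torus (meridian z)"

definition e2 :: "complex \<times> complex \<Rightarrow> (real \<Rightarrow> complex \<times> complex) set" where
  "e2 z = path_class torus (longitude z)"

type_synonym torus_pair = "(complex \<times> complex) \<times> (complex \<times> complex)"

abbreviation F2T :: "torus_pair set" where
  "F2T \<equiv> conf2 torus"

abbreviation P2T :: "torus_pair \<Rightarrow> (real \<Rightarrow> torus_pair) set monoid" where
  "P2T z \<equiv> pi1 F2T z"

text \<open>Under \<open>P\<^sub>2 \<cong> F\<^sub>2(u,v) \<times> \<int>\<^sup>2\<close> the free factor is the kernel of the homomorphism induced by the
  second projection; the free generators \<open>u, v\<close> themselves need not be named to describe its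
  elements.\<close>

definition free_factor :: "torus_pair \<Rightarrow> (real \<Rightarrow> torus_pair) set set" where
  "free_factor z = kernel (P2T z) (pi1 torus (snd z)) (pi1_map torus snd)"

text \<open>The basis \<open>x, y\<close> of the centre: both points move together along the meridian,
  respectively the longitude.\<close>

definition central_x :: "torus_pair \<Rightarrow> (real \<Rightarrow> torus_pair) set" where
  "central_x z = path_class F2T (\<lambda>t. (meridian (fst z) t, meridian (snd z) t))"

definition central_y :: "torus_pair \<Rightarrow> (real \<Rightarrow> torus_pair) set" where
  "central_y z = path_class F2T (\<lambda>t. (longitude (fst z) t, longitude (snd z) t))"

text \<open>The element \<open>g x\<^sup>m y\<^sup>n\<close> of \<open>P2T z\<close>, written \<open>(g, (m, n))\<close> under the identification with
  \<open>F\<^sub>2(u,v) \<times> \<int>\<^sup>2\<close>, for \<open>g\<close> in the free factor.\<close>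

definition braid ::
  "torus_pair \<Rightarrow> (real \<Rightarrow> torus_pair) set \<times> (int \<times> int) \<Rightarrow> (real \<Rightarrow> torus_pair) set" where
  "braid z = (\<lambda>(g, m, n).
     g \<otimes>\<^bsub>P2T z\<^esub> (central_x z [^]\<^bsub>P2T z\<^esub> m) \<otimes>\<^bsub>P2T z\<^esub> (central_y z [^]\<^bsub>P2T z\<^esub> n))"

lemma meridian_loop:
  assumes "z \<in> torus"
  shows "meridian z \<in> loops_at torus z"
proof -
  have "continuous_on {0..1} (meridian z)"
    unfolding meridian_def by (intro continuous_intros)
  moreover have "meridian z t \<in> torus" for t
    using assms by (auto simp: meridian_def torus_def norm_mult)
  ultimately show ?thesis
    unfolding loops_at_def path_def path_image_def pathstart_def pathfinish_def
    by (auto simp: meridian_def)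
qed

lemma longitude_loop:
  assumes "z \<in> torus"
  shows "longitude z \<in> loops_at torus z"
proof -
  have "continuous_on {0..1} (longitude z)"
    unfolding longitude_def by (intro continuous_intros)
  moreover have "longitude z t \<in> torus" for t
    using assms by (auto simp: longitude_def torus_def norm_mult)
  ultimately show ?thesis
    unfolding loops_at_def path_def path_image_def pathstart_def pathfinish_def
    by (auto simp: longitude_def)
qed

lemma central_x_loop:
  assumes "z \<in> F2T"
  shows "(\<lambda>t. (meridian (fst z) t, meridian (snd z) t)) \<in> loops_at F2T z"
proof -
  have z: "fst z \<in> torus" "snd z \<in> torus" "fst z \<noteq> snd z"
    using assms by (auto simp: conf2_def)
  note l = meridian_loop[OF z(1)] meridian_loop[OF z(2)]
  have "continuous_on {0..1} (\<lambda>t. (meridian (fst z) t, meridian (snd z) t))"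
    using l by (intro continuous_on_Pair) (simp_all add: loops_at_def path_def)
  moreover have "meridian (fst z) t \<noteq> meridian (snd z) t" for t
    using z(3) by (simp add: meridian_def prod_eq_iff)
  moreover have "meridian (fst z) t \<in> torus" "meridian (snd z) t \<in> torus" if "t \<in> {0..1}" for t
    using l that unfolding loops_at_def path_image_def by blast+
  ultimately have "path (\<lambda>t. (meridian (fst z) t, meridian (snd z) t))"
    and "path_image (\<lambda>t. (meridian (fst z) t, meridian (snd z) t)) \<subseteq> F2T"
    unfolding path_def path_image_def conf2_def by blast+
  then show ?thesis
    using l unfolding loops_at_def pathstart_def pathfinish_def by simp
qed

lemma central_y_loop:
  assumes "z \<in> F2T"
  shows "(\<lambda>t. (longitude (fst z) t, longitude (snd z) t)) \<in> loops_at F2T z"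
proof -
  have z: "fst z \<in> torus" "snd z \<in> torus" "fst z \<noteq> snd z"
    using assms by (auto simp: conf2_def)
  note l = longitude_loop[OF z(1)] longitude_loop[OF z(2)]
  have "continuous_on {0..1} (\<lambda>t. (longitude (fst z) t, longitude (snd z) t))"
    using l by (intro continuous_on_Pair) (simp_all add: loops_at_def path_def)
  moreover have "longitude (fst z) t \<noteq> longitude (snd z) t" for t
    using z(3) by (simp add: longitude_def prod_eq_iff)
  moreover have "longitude (fst z) t \<in> torus" "longitude (snd z) t \<in> torus" if "t \<in> {0..1}" for t
    using l that unfolding loops_at_def path_image_def by blast+
  ultimately have "path (\<lambda>t. (longitude (fst z) t, longitude (snd z) t))"
    and "path_image (\<lambda>t. (longitude (fst z) t, longitude (snd z) t)) \<subseteq> F2T"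
    unfolding path_def path_image_def conf2_def by blast+
  then show ?thesis
    using l unfolding loops_at_def pathstart_def pathfinish_def by simp
qed

lemma proj_central:
  assumes "z \<in> F2T"
  shows "pi1_map torus fst (central_x z) = e1 (fst z)"
    and "pi1_map torus snd (central_x z) = e1 (snd z)"
    and "pi1_map torus fst (central_y z) = e2 (fst z)"
    and "pi1_map torus snd (central_y z) = e2 (snd z)"
proof -
  have f: "continuous_on F2T fst" "fst \<in> F2T \<rightarrow> torus"
    and s: "continuous_on F2T snd" "snd \<in> F2T \<rightarrow> torus"
    by (auto simp: conf2_def intro!: continuous_intros)
  note x = central_x_loop[OF assms] and y = central_y_loop[OF assms]
  show "pi1_map torus fst (central_x z) = e1 (fst z)"
    and "pi1_map torus snd (central_x z) = e1 (snd z)"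
    and "pi1_map torus fst (central_y z) = e2 (fst z)"
    and "pi1_map torus snd (central_y z) = e2 (snd z)"
    unfolding central_x_def central_y_def e1_def e2_def
      pi1_map_class[OF f x] pi1_map_class[OF s x] pi1_map_class[OF f y] pi1_map_class[OF s y]
    by (simp_all add: comp_def)
qed

end

theory Submission
  imports Defs "HOL-Complex_Analysis.Riemann_Mapping"
begin

text \<open>The proof replaces the lift by an explicit homotopic map into the configuration space
\<open>F2T\<close> and then makes that map fixed point free by a generic rotation.

Let \<open>p\<close> be a loop in \<open>F2T\<close> that represents \<open>w\<close>. In
coordinates \<open>x, y\<close> with unit period on the torus, consider the map that evaluates
\<open>p\<close> at time \<open>r x + s y\<close> and moves the resulting pair of points
rigidly by \<open>(a x + c y, b x + d y)\<close>. It sends the two basis elements of the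
fundamental group to the prescribed braids (lemma \<open>model_map_classes\<close>).

Two maps from the torus to \<open>F2T\<close> that agree on the fundamental group are homotopic
(lemmas \<open>torus_maps_homotopic\<close> and \<open>F2T_cube_extension\<close>), because every
map of a 2-sphere into \<open>F2T\<close> extends over the ball. Lifting both points to the plane
reduces this to the fact that a map from a compact, simply connected, locally path connected space
to a plane domain is null-homotopic (theorem \<open>planar_nullhomotopic\<close>). That is proved
by Koebe's iterated square roots. A bounded domain is covered again and again by domains in the
unit disc, each step removing a point omitted so far. By the Schwarz--Pick lemma the lifts of the
given map stay in one compact part of the disc, and by the Schwarz lemma the derivatives of the
coverings stay away from zero. Each step that removes a point of that compact part shrinks the
derivative by a fixed factor, so after finitely many steps the covering domain contains the
compact part. There the lift is contracted, and the covering carries the contraction back.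

For the explicit map, the relation \<open>s (a - 1, b) = r (c, d - 1)\<close> says that
the displacement of a point under either component depends on the real number
\<open>r x + s y\<close> alone (lemma \<open>model_map_generic_shift\<close>). The possible
displacements form two curves in the torus, which are negligible once \<open>p\<close> is smooth.
A rotation off these curves, applied to both points, removes all fixed points and is joined to the
identity by rotations, so the two-valued map is deformed as required.\<close>

section \<open>Hyperbolic estimates in the unit disc\<close>

text \<open>The automorphism \<open>z \<mapsto> (z - w) / (1 - cnj w * z)\<close> of
the unit disc, which carries \<open>w\<close> to the origin; its inverse is the shift by
\<open>- w\<close>.\<close>

abbreviation disc_shift :: "complex \<Rightarrow> complex \<Rightarrow> complex" where
  "disc_shift \<equiv> Moebius_function 0"

lemma disc_shift_inverse:
  assumes "norm w < 1" "norm z < 1"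
  shows "disc_shift w (disc_shift (- w) z) = z" "disc_shift (- w) (disc_shift w z) = z"
  using Moebius_function_compose[of w "-w" z] Moebius_function_compose[of "-w" w z] assms by auto

text \<open>A point at pseudo-hyperbolic distance at most \<open>1/2\<close> from the disc of
radius \<open>\<rho>\<close> cannot be close to the unit circle. This follows from the identity
\<open>|1 - cnj c * w|\<^sup>2 - |w - c|\<^sup>2 = (1 - |c|\<^sup>2) * (1 - |w|\<^sup>2)\<close>.
The constant is crude; all that matters is that the bound is below \<open>1\<close> and depends on
\<open>\<rho>\<close> only.\<close>

lemma pick_distance_bound:
  fixes c w :: complex
  assumes c: "norm c \<le> \<rho>" and w: "norm w < 1" and \<rho>: "\<rho> < 1"
    and close: "norm (w - c) \<le> norm (1 - cnj c * w) / 2"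
  shows "norm w \<le> sqrt (1 - 3/4 * (1 - \<rho>)\<^sup>2)"
proof -
  have id: "(norm (1 - cnj c * w))\<^sup>2 - (norm (w - c))\<^sup>2 = (1 - (norm c)\<^sup>2) * (1 - (norm w)\<^sup>2)"
    unfolding cmod_power2 by (simp add: power2_eq_square algebra_simps)
  have c1: "norm c < 1"
    using c \<rho> by simp
  have "norm (cnj c * w) \<le> \<rho> * 1"
    unfolding norm_mult complex_mod_cnj using c w by (intro mult_mono) (auto intro: order_trans[OF norm_ge_zero])
  then have "1 - \<rho> \<le> norm (1 - cnj c * w)"
    using norm_triangle_ineq2[of 1 "cnj c * w"] by simp
  then have "(1 - \<rho>)\<^sup>2 \<le> (norm (1 - cnj c * w))\<^sup>2"
    using \<rho> by (intro power_mono) auto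
  moreover have "(norm (w - c))\<^sup>2 \<le> (norm (1 - cnj c * w) / 2)\<^sup>2"
    using close by (intro power_mono) auto
  ultimately have "3/4 * (1 - \<rho>)\<^sup>2 \<le> (1 - (norm c)\<^sup>2) * (1 - (norm w)\<^sup>2)"
    using id by (simp add: power_divide)
  also have "\<dots> \<le> 1 * (1 - (norm w)\<^sup>2)"
    using w by (intro mult_right_mono) (auto simp: abs_square_le_1 power_le_one)
  finally have "(norm w)\<^sup>2 \<le> 1 - 3/4 * (1 - \<rho>)\<^sup>2"
    by simp
  then show ?thesis
    using real_le_rsqrt by blast
qed

text \<open>The Schwarz lemma after moving \<open>v y\<close> to the origin and rescaling the
ball to the unit disc.\<close>

lemma Schwarz_Pick_ball:
  assumes hol: "v holomorphic_on ball y e" and im: "v \<in> ball y e \<rightarrow> ball 0 1" and e: "0 < e"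
    and u: "u \<in> ball y e"
  shows "norm (disc_shift (v y) (v u)) \<le> norm (u - y) / e"
proof -
  have vy: "norm (v y) < 1"
    using im e by (force simp: Pi_iff)
  have map: "y + of_real e * z \<in> ball y e" if "norm z < 1" for z
    using that e by (simp add: dist_norm norm_mult)
  define h where "h \<equiv> disc_shift (v y) \<circ> (v \<circ> (\<lambda>z. y + of_real e * z))"
  have "h holomorphic_on ball 0 1"
    unfolding h_def
  proof (intro holomorphic_on_compose)
    show "v holomorphic_on (\<lambda>z. y + of_real e * z) ` ball 0 1"
      using map by (intro holomorphic_on_subset[OF hol]) auto
    show "disc_shift (v y) holomorphic_on (v \<circ> (\<lambda>z. y + of_real e * z)) ` ball 0 1"
      using map im by (intro holomorphic_on_subset[OF Moebius_function_holomorphic[OF vy]]) force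
  qed (intro holomorphic_intros)
  moreover have "h 0 = 0"
    by (simp add: h_def Moebius_function_eq_zero)
  moreover have "norm (h z) < 1" if "norm z < 1" for z
    using map[OF that] im vy by (auto simp: h_def Pi_iff intro!: Moebius_function_norm_lt_1)
  moreover have n: "norm ((u - y) / of_real e) < 1"
    using u e by (simp add: norm_divide dist_norm norm_minus_commute)
  ultimately have "norm (h ((u - y) / of_real e)) \<le> norm ((u - y) / of_real e)"
    by (rule Schwarz_Lemma(1))
  then show ?thesis
    using e by (simp add: h_def norm_divide)
qed

section \<open>Coverings of plane domains by domains in the disc\<close>

text \<open>The covering property is recorded through holomorphic sections over round balls.
Unlike evenly covered neighbourhoods, sections over a ball of prescribed radius compose, and they
are what the Schwarz--Pick estimate is applied to.\<close>

definition disc_cover :: "complex set \<Rightarrow> complex set \<Rightarrow> (complex \<Rightarrow> complex) \<Rightarrow> bool" where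
  "disc_cover \<Omega> U P \<longleftrightarrow> open U \<and> U \<subseteq> ball 0 1 \<and> P holomorphic_on U \<and> P \<in> U \<rightarrow> \<Omega> \<and>
     (\<forall>z\<in>U. \<forall>e. ball (P z) e \<subseteq> \<Omega> \<longrightarrow>
        (\<exists>v. v holomorphic_on ball (P z) e \<and> v \<in> ball (P z) e \<rightarrow> U \<and>
             (\<forall>x\<in>ball (P z) e. P (v x) = x) \<and> v (P z) = z))"

lemma disc_cover_id:
  assumes "open \<Omega>" "\<Omega> \<subseteq> ball 0 1"
  shows "disc_cover \<Omega> \<Omega> (\<lambda>z. z)"
  unfolding disc_cover_def using assms
  by (auto intro!: exI[of _ "\<lambda>z. z"] holomorphic_intros)

lemma disc_cover_deriv:
  assumes cov: "disc_cover \<Omega> U P" and z: "z \<in> U" and e: "0 < e" "ball (P z) e \<subseteq> \<Omega>"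
  obtains v where "v holomorphic_on ball (P z) e" "v \<in> ball (P z) e \<rightarrow> U"
    "\<And>x. x \<in> ball (P z) e \<Longrightarrow> P (v x) = x" "v (P z) = z" "deriv P z * deriv v (P z) = 1"
proof -
  obtain v where v: "v holomorphic_on ball (P z) e" "v \<in> ball (P z) e \<rightarrow> U"
    "\<forall>x\<in>ball (P z) e. P (v x) = x" "v (P z) = z"
    using cov z e unfolding disc_cover_def by blast
  have "P holomorphic_on U" "open U"
    using cov by (auto simp: disc_cover_def)
  then have dP: "(P has_field_derivative deriv P z) (at (v (P z)))"
    using z v(4) by (simp add: holomorphic_derivI)
  have dv: "(v has_field_derivative deriv v (P z)) (at (P z))"
    using v(1) e(1) by (intro holomorphic_derivI[of _ "ball (P z) e"]) auto
  have "(P \<circ> v has_field_derivative deriv P z * deriv v (P z)) (at (P z))"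
    using dP dv by (rule DERIV_chain)
  moreover have "(P \<circ> v has_field_derivative 1) (at (P z))"
    by (rule has_field_derivative_transform_within_open[OF DERIV_ident, of "ball (P z) e"])
       (use v(3) e(1) in auto)
  ultimately have "deriv P z * deriv v (P z) = 1"
    by (rule DERIV_unique)
  then show ?thesis
    using v that by blast
qed

text \<open>A section \<open>v\<close> gives \<open>P' * v' = 1\<close>, so \<open>P\<close>
is locally injective and two lifts that agree at one point agree on an open and closed
set.\<close>

lemma disc_cover_lift_unique:
  assumes cov: "disc_cover \<Omega> U P" and \<Omega>: "open \<Omega>" and C: "connected C"
    and g: "continuous_on C g" "g \<in> C \<rightarrow> U" and h: "continuous_on C h" "h \<in> C \<rightarrow> U"
    and eq: "\<And>x. x \<in> C \<Longrightarrow> P (g x) = P (h x)" and c: "c \<in> C" "g c = h c" and x: "x \<in> C"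
  shows "g x = h x"
proof -
  have U: "open U" "P holomorphic_on U" "P \<in> U \<rightarrow> \<Omega>"
    using cov by (auto simp: disc_cover_def)
  have "openin (top_of_set C) {x\<in>C. g x = h x}"
  proof (subst openin_subopen, safe)
    fix x assume x: "x \<in> C" "g x = h x"
    have gU: "g x \<in> U" using x g(2) by blast
    then obtain e where e: "e > 0" "ball (P (g x)) e \<subseteq> \<Omega>"
      using U(3) \<Omega> open_contains_ball by (metis Pi_iff)
    then have "deriv P (g x) \<noteq> 0"
      using disc_cover_deriv[OF cov gU e] by (metis mult_zero_left zero_neq_one)
    then obtain r where r: "r > 0" "inj_on P (ball (g x) r)"
      using has_complex_derivative_locally_injective[OF U(2) gU U(1)] by blast
    define T where "T \<equiv> (C \<inter> g -` ball (g x) r) \<inter> (C \<inter> h -` ball (g x) r)"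
    have "openin (top_of_set C) T"
      unfolding T_def using g(1) h(1) by (intro openin_Int continuous_openin_preimage_gen) auto
    moreover have "x \<in> T"
      using x r by (auto simp: T_def)
    moreover have "T \<subseteq> {x\<in>C. g x = h x}"
      using r(2) eq by (auto simp: T_def inj_on_def)
    ultimately show "\<exists>T. openin (top_of_set C) T \<and> x \<in> T \<and> T \<subseteq> {x \<in> C. g x = h x}"
      by blast
  qed
  moreover have "closedin (top_of_set C) {x\<in>C. g x = h x}"
    using continuous_closedin_preimage_constant[of C "\<lambda>x. g x - h x" 0] g(1) h(1)
    by (simp add: continuous_on_diff)
  ultimately have "{x\<in>C. g x = h x} = C"
    using C c unfolding connected_clopen by blast
  then show ?thesis using x by blast
qed

section \<open>The square root covering of the disc\<close>

text \<open>The squaring map of the disc, conjugated by automorphisms so that the origin is fixed.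
Its only branch value is \<open>- b\<^sup>2\<close>, hence it is a double covering of every
domain that omits this point.\<close>

definition koebe :: "complex \<Rightarrow> complex \<Rightarrow> complex" where
  "koebe b z = disc_shift (b\<^sup>2) ((disc_shift (- b) z)\<^sup>2)"

lemma koebe_holomorphic:
  assumes b: "norm b < 1"
  shows "koebe b holomorphic_on ball 0 1"
proof -
  have b2: "norm (b\<^sup>2) < 1" using b by (simp add: norm_power power_less_one_iff)
  have b': "norm (-b) < 1" using b by simp
  have "(disc_shift (b\<^sup>2) \<circ> (\<lambda>z. (disc_shift (- b) z)\<^sup>2)) holomorphic_on ball 0 1"
  proof (intro holomorphic_on_compose)
    show "(\<lambda>z. (disc_shift (- b) z)\<^sup>2) holomorphic_on ball 0 1"
      using Moebius_function_holomorphic[OF b'] by (intro holomorphic_intros)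
    show "disc_shift (b\<^sup>2) holomorphic_on (\<lambda>z. (disc_shift (- b) z)\<^sup>2) ` ball 0 1"
      using Moebius_function_norm_lt_1[OF b']
      by (intro holomorphic_on_subset[OF Moebius_function_holomorphic[OF b2]])
         (auto simp: norm_power power_less_one_iff)
  qed
  then show ?thesis
    by (simp add: koebe_def[abs_def] comp_def)
qed

lemma koebe_0: "koebe b 0 = 0"
  by (simp add: koebe_def Moebius_function_of_zero Moebius_function_eq_zero)

lemma koebe_deriv_0:
  assumes b: "norm b < 1"
  shows "norm (deriv (koebe b) 0) = 2 * norm b / (1 + (norm b)\<^sup>2)"
proof -
  define c where "c \<equiv> b * cnj b"
  have c: "c = of_real ((norm b)\<^sup>2)"
    by (metis c_def complex_norm_square)
  have n1: "(norm b)\<^sup>2 < 1"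
    using b by (simp add: power_less_one_iff)
  have n2: "((norm b)\<^sup>2)\<^sup>2 < 1"
    using n1 by (simp add: power_less_one_iff)
  have "1 - c = of_real (1 - (norm b)\<^sup>2)" "1 + c = of_real (1 + (norm b)\<^sup>2)"
    "1 - c\<^sup>2 = of_real (1 - ((norm b)\<^sup>2)\<^sup>2)"
    by (simp_all add: c)
  moreover have "1 + (norm b)\<^sup>2 \<noteq> 0"
    by (metis add_nonneg_eq_0_iff zero_le_one zero_le_power2 zero_neq_one)
  ultimately have ne: "1 - c \<noteq> 0" "1 + c \<noteq> 0" "1 - c\<^sup>2 \<noteq> 0"
    using n1 n2 by (simp_all only: of_real_eq_0_iff) auto
  have inner: "(disc_shift (- b) has_field_derivative 1 - c) (at 0)"
    unfolding Moebius_function_simple[abs_def]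
    by (rule derivative_eq_intros refl | simp add: c_def)+
  have "((\<lambda>u. (u\<^sup>2 - b\<^sup>2) / (1 - cnj (b\<^sup>2) * u\<^sup>2)) has_field_derivative 2 * b / (1 - c\<^sup>2)) (at b)"
  proof (rule DERIV_cong)
    show "((\<lambda>u. (u\<^sup>2 - b\<^sup>2) / (1 - cnj (b\<^sup>2) * u\<^sup>2)) has_field_derivative
        (2 * b * (1 - cnj (b\<^sup>2) * b\<^sup>2) - (b\<^sup>2 - b\<^sup>2) * (- (cnj (b\<^sup>2) * (2 * b)))) /
        ((1 - cnj (b\<^sup>2) * b\<^sup>2) * (1 - cnj (b\<^sup>2) * b\<^sup>2))) (at b)"
      using ne(3) by (intro DERIV_divide) (auto intro!: derivative_eq_intros simp: c_def power_mult_distrib mult.commute)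
    have "cnj (b\<^sup>2) * b\<^sup>2 = c\<^sup>2" by (simp add: c_def power_mult_distrib mult.commute)
    then show "(2 * b * (1 - cnj (b\<^sup>2) * b\<^sup>2) - (b\<^sup>2 - b\<^sup>2) * (- (cnj (b\<^sup>2) * (2 * b)))) /
        ((1 - cnj (b\<^sup>2) * b\<^sup>2) * (1 - cnj (b\<^sup>2) * b\<^sup>2)) = 2 * b / (1 - c\<^sup>2)"
      using ne(3) by simp
  qed
  moreover have "disc_shift (- b) 0 = b" by (simp add: Moebius_function_of_zero)
  ultimately have "((\<lambda>u. (u\<^sup>2 - b\<^sup>2) / (1 - cnj (b\<^sup>2) * u\<^sup>2)) \<circ> disc_shift (- b) has_field_derivative
      2 * b / (1 - c\<^sup>2) * (1 - c)) (at 0)"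
    using inner by (intro DERIV_chain) auto
  moreover have "koebe b = (\<lambda>u. (u\<^sup>2 - b\<^sup>2) / (1 - cnj (b\<^sup>2) * u\<^sup>2)) \<circ> disc_shift (- b)"
    by (simp add: koebe_def[abs_def] Moebius_function_simple comp_def)
  ultimately have "(koebe b has_field_derivative 2 * b * (1 - c) / (1 - c\<^sup>2)) (at 0)"
    by simp
  then have "deriv (koebe b) 0 = 2 * b * (1 - c) / (1 - c\<^sup>2)"
    by (rule DERIV_imp_deriv)
  also have "\<dots> = 2 * b / (1 + c)"
    using ne by (simp add: divide_simps) (simp add: algebra_simps power2_eq_square)
  finally have "norm (deriv (koebe b) 0) = norm (2 * b) / norm (1 + c)"
    by (simp add: norm_divide)
  also have "norm (1 + c) = 1 + (norm b)\<^sup>2"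
  proof -
    have "1 + c = of_real (1 + (norm b)\<^sup>2)" by (simp add: c)
    then show ?thesis by (simp only: norm_of_real) simp
  qed
  finally show ?thesis by (simp add: norm_mult)
qed

text \<open>Every square root of the shifted point gives a preimage under the square root
covering; all liftings below amount to choosing such a root continuously or
holomorphically.\<close>

lemma koebe_section:
  assumes b: "norm b < 1" and u: "norm u < 1" and g: "g\<^sup>2 = disc_shift (- (b\<^sup>2)) u"
  shows "norm g < 1" "norm (disc_shift b g) < 1" "koebe b (disc_shift b g) = u"
proof -
  have b2: "norm (b\<^sup>2) < 1" using b by (simp add: norm_power power_less_one_iff)
  have "norm (g\<^sup>2) < 1"
    unfolding g using b2 u by (intro Moebius_function_norm_lt_1) auto
  then show g1: "norm g < 1"
    by (simp add: norm_power power_less_one_iff)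
  show "norm (disc_shift b g) < 1"
    using b g1 by (rule Moebius_function_norm_lt_1)
  show "koebe b (disc_shift b g) = u"
    unfolding koebe_def by (simp add: disc_shift_inverse b g1 g b2 u)
qed

lemma koebe_avoids:
  assumes b: "norm b < 1" and u: "norm u < 1" "u \<noteq> - (b\<^sup>2)"
  shows "disc_shift (- (b\<^sup>2)) u \<noteq> 0"
proof
  have b2: "norm (b\<^sup>2) < 1" using b by (simp add: norm_power power_less_one_iff)
  assume "disc_shift (- (b\<^sup>2)) u = 0"
  then have "disc_shift (b\<^sup>2) 0 = u"
    using disc_shift_inverse(1)[OF b2 u(1)] by simp
  then show False
    using u by (simp add: Moebius_function_of_zero)
qed

lemma koebe_root_at:
  assumes b: "norm b < 1" and z: "norm z < 1" and g: "g\<^sup>2 = disc_shift (- (b\<^sup>2)) (koebe b z)"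
  shows "g = disc_shift (- b) z \<or> g = - disc_shift (- b) z"
proof -
  have b2: "norm (b\<^sup>2) < 1" using b by (simp add: norm_power power_less_one_iff)
  have "norm ((disc_shift (- b) z)\<^sup>2) < 1"
    using b z by (auto simp: norm_power power_less_one_iff Moebius_function_norm_lt_1)
  then have "g\<^sup>2 = (disc_shift (- b) z)\<^sup>2"
    using g b2 by (simp add: koebe_def disc_shift_inverse)
  then show ?thesis by (simp add: power2_eq_iff)
qed

text \<open>The domain is simply connected, so a continuous square root exists; its sign is
adjusted so that the lift starts at the prescribed point.\<close>

lemma koebe_lift_continuous:
  fixes h :: "'a::real_normed_vector \<Rightarrow> complex"
  assumes b: "norm b < 1" and S: "simply_connected S" "locally path_connected S"
    and h: "continuous_on S h" "h \<in> S \<rightarrow> ball 0 1 - {- (b\<^sup>2)}"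
    and s: "s \<in> S" "norm z < 1" "koebe b z = h s"
  obtains h' where "continuous_on S h'" "h' \<in> S \<rightarrow> ball 0 1" "\<And>x. x \<in> S \<Longrightarrow> koebe b (h' x) = h x"
    "h' s = z"
proof -
  have b2: "norm (- (b\<^sup>2)) < 1" using b by (simp add: norm_power power_less_one_iff)
  have h1: "norm (h x) < 1" "h x \<noteq> - (b\<^sup>2)" if "x \<in> S" for x
    using h(2) that by (auto simp: Pi_iff)
  have "continuous_on S (disc_shift (- (b\<^sup>2)) \<circ> h)"
    using h1 by (intro continuous_on_compose h(1)
        continuous_on_subset[OF holomorphic_on_imp_continuous_on[OF Moebius_function_holomorphic[OF b2]]]) auto
  then obtain g0 where g0: "continuous_on S g0" "\<And>x. x \<in> S \<Longrightarrow> disc_shift (- (b\<^sup>2)) (h x) = (g0 x)\<^sup>2"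
    using continuous_sqrt_on_simply_connected[OF _ S, of "disc_shift (- (b\<^sup>2)) \<circ> h"] koebe_avoids[OF b h1]
    by (auto simp: comp_def)
  have "g0 s = disc_shift (- b) z \<or> g0 s = - disc_shift (- b) z"
    using s g0(2)[OF s(1)] by (intro koebe_root_at[OF b]) auto
  then obtain \<sigma> :: complex where \<sigma>: "\<sigma> * g0 s = disc_shift (- b) z" "\<sigma>\<^sup>2 = 1"
    by (metis minus_minus mult_1 mult_minus1 power2_minus power_one)
  define g where "g \<equiv> \<lambda>x. \<sigma> * g0 x"
  have g: "continuous_on S g" "\<And>x. x \<in> S \<Longrightarrow> (g x)\<^sup>2 = disc_shift (- (b\<^sup>2)) (h x)" "g s = disc_shift (- b) z"
    using g0 \<sigma> by (auto simp: g_def power_mult_distrib intro!: continuous_intros)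
  note sec = koebe_section[OF b h1(1) g(2)]
  show ?thesis
  proof
    show "continuous_on S (disc_shift b \<circ> g)"
      using sec by (intro continuous_on_compose g(1)
        continuous_on_subset[OF holomorphic_on_imp_continuous_on[OF Moebius_function_holomorphic[OF b]]]) auto
    show "disc_shift b \<circ> g \<in> S \<rightarrow> ball 0 1" using sec by auto
    show "koebe b ((disc_shift b \<circ> g) x) = h x" if "x \<in> S" for x using sec that by simp
    show "(disc_shift b \<circ> g) s = z" using g(3) b s(2) by (simp add: disc_shift_inverse)
  qed
qed

lemma koebe_lift_holomorphic:
  assumes b: "norm b < 1" and S: "convex S"
    and h: "h holomorphic_on S" "h \<in> S \<rightarrow> ball 0 1 - {- (b\<^sup>2)}"
    and s: "s \<in> S" "norm z < 1" "koebe b z = h s"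
  obtains h' where "h' holomorphic_on S" "h' \<in> S \<rightarrow> ball 0 1" "\<And>x. x \<in> S \<Longrightarrow> koebe b (h' x) = h x"
    "h' s = z"
proof -
  have b2: "norm (- (b\<^sup>2)) < 1" using b by (simp add: norm_power power_less_one_iff)
  have h1: "norm (h x) < 1" "h x \<noteq> - (b\<^sup>2)" if "x \<in> S" for x
    using h(2) that by (auto simp: Pi_iff)
  have "(disc_shift (- (b\<^sup>2)) \<circ> h) holomorphic_on S"
    using h1 by (intro holomorphic_on_compose h(1)
        holomorphic_on_subset[OF Moebius_function_holomorphic[OF b2]]) auto
  then obtain g0 where g0: "g0 holomorphic_on S" "\<And>x. x \<in> S \<Longrightarrow> disc_shift (- (b\<^sup>2)) (h x) = (g0 x)\<^sup>2"
    using contractible_imp_holomorphic_sqrt[OF _ convex_imp_contractible[OF S], of "disc_shift (- (b\<^sup>2)) \<circ> h"]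
      koebe_avoids[OF b h1]
    by (auto simp: comp_def)
  have "g0 s = disc_shift (- b) z \<or> g0 s = - disc_shift (- b) z"
    using s g0(2)[OF s(1)] by (intro koebe_root_at[OF b]) auto
  then obtain \<sigma> :: complex where \<sigma>: "\<sigma> * g0 s = disc_shift (- b) z" "\<sigma>\<^sup>2 = 1"
    by (metis minus_minus mult_1 mult_minus1 power2_minus power_one)
  define g where "g \<equiv> \<lambda>x. \<sigma> * g0 x"
  have g: "g holomorphic_on S" "\<And>x. x \<in> S \<Longrightarrow> (g x)\<^sup>2 = disc_shift (- (b\<^sup>2)) (h x)" "g s = disc_shift (- b) z"
    using g0 \<sigma> by (auto simp: g_def power_mult_distrib intro!: holomorphic_intros)
  note sec = koebe_section[OF b h1(1) g(2)]
  show ?thesis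
  proof
    show "(disc_shift b \<circ> g) holomorphic_on S"
      using sec by (intro holomorphic_on_compose g(1)
        holomorphic_on_subset[OF Moebius_function_holomorphic[OF b]]) auto
    show "disc_shift b \<circ> g \<in> S \<rightarrow> ball 0 1" using sec by auto
    show "koebe b ((disc_shift b \<circ> g) x) = h x" if "x \<in> S" for x using sec that by simp
    show "(disc_shift b \<circ> g) s = z" using g(3) b s(2) by (simp add: disc_shift_inverse)
  qed
qed

text \<open>A section over a ball takes values in \<open>U\<close>, which omits the branch value,
so it lifts once more through the square root covering.\<close>

lemma disc_cover_koebe:
  assumes cov: "disc_cover \<Omega> U P" and b: "norm b < 1" and nb: "- (b\<^sup>2) \<notin> U"
  shows "disc_cover \<Omega> {z \<in> ball 0 1. koebe b z \<in> U} (P \<circ> koebe b)"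
proof -
  let ?V = "{z \<in> ball 0 1. koebe b z \<in> U}"
  have U: "open U" "U \<subseteq> ball 0 1" "P holomorphic_on U" "P \<in> U \<rightarrow> \<Omega>"
    using cov by (auto simp: disc_cover_def)
  have "open (ball 0 1 \<inter> koebe b -` U)"
    using U(1) by (intro continuous_open_preimage holomorphic_on_imp_continuous_on koebe_holomorphic b) auto
  moreover have "ball 0 1 \<inter> koebe b -` U = ?V" by auto
  ultimately have "open ?V" by simp
  moreover have "P \<circ> koebe b holomorphic_on ?V"
    by (intro holomorphic_on_compose holomorphic_on_subset[OF koebe_holomorphic[OF b]]
        holomorphic_on_subset[OF U(3)]) auto
  moreover have "P \<circ> koebe b \<in> ?V \<rightarrow> \<Omega>"
    using U(4) by auto
  moreover have "\<exists>v. v holomorphic_on ball ((P \<circ> koebe b) z) e \<and> v \<in> ball ((P \<circ> koebe b) z) e \<rightarrow> ?V \<and>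
             (\<forall>x\<in>ball ((P \<circ> koebe b) z) e. (P \<circ> koebe b) (v x) = x) \<and> v ((P \<circ> koebe b) z) = z"
    if z: "z \<in> ?V" and e: "ball ((P \<circ> koebe b) z) e \<subseteq> \<Omega>" for z e
  proof (cases "e > 0")
    case False
    then show ?thesis by (intro exI[of _ "\<lambda>_. z"]) (auto simp: ball_empty)
  next
    case True
    define B where "B \<equiv> ball ((P \<circ> koebe b) z) e"
    obtain v where v: "v holomorphic_on B" "v \<in> B \<rightarrow> U" "\<forall>x\<in>B. P (v x) = x" "v (P (koebe b z)) = koebe b z"
      using cov z e unfolding disc_cover_def B_def comp_def by blast
    have "v \<in> B \<rightarrow> ball 0 1 - {- (b\<^sup>2)}"
    proof
      fix x assume "x \<in> B"
      then have "v x \<in> U" using v(2) by blast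
      then show "v x \<in> ball 0 1 - {- (b\<^sup>2)}" using U(2) nb by auto
    qed
    then obtain v' where "v' holomorphic_on B" "v' \<in> B \<rightarrow> ball 0 1" "\<And>x. x \<in> B \<Longrightarrow> koebe b (v' x) = v x"
      "v' (P (koebe b z)) = z"
      using koebe_lift_holomorphic[OF b _ v(1), of "P (koebe b z)" z] True z v(4)
      by (auto simp: B_def)
    then have "v' holomorphic_on B \<and> v' \<in> B \<rightarrow> ?V \<and>
             (\<forall>x\<in>B. (P \<circ> koebe b) (v' x) = x) \<and> v' ((P \<circ> koebe b) z) = z"
      using v(2,3) by (auto simp: Pi_iff)
    then show ?thesis unfolding B_def by blast
  qed
  ultimately show ?thesis
    unfolding disc_cover_def by auto
qed

text \<open>The derivative at the origin has modulus
\<open>2t / (1 + t\<^sup>2) = 1 - (1 - t)\<^sup>2 / (1 + t\<^sup>2)\<close> with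
\<open>t = |b|\<close>. As long as the omitted point stays in a fixed compact part of the disc,
each further covering shrinks the derivative by a fixed factor.\<close>

lemma koebe_contraction_factor:
  assumes b: "(norm b)\<^sup>2 \<le> \<rho>" and \<rho>: "\<rho> < 1"
  shows "norm (deriv (koebe b) 0) \<le> 1 - (1 - sqrt \<rho>)\<^sup>2 / 2"
proof -
  have \<rho>0: "0 \<le> \<rho>" using b by (rule order_trans[rotated]) simp
  define t where "t = norm b"
  have t: "0 \<le> t" "t \<le> sqrt \<rho>" "sqrt \<rho> < 1"
    using b \<rho> \<rho>0 by (auto simp: t_def intro: real_le_rsqrt)
  then have t1: "t < 1" by linarith
  have "norm (deriv (koebe b) 0) = 2 * t / (1 + t\<^sup>2)"
    using koebe_deriv_0[of b] t1 by (simp add: t_def)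
  also have "\<dots> = 1 - (1 - t)\<^sup>2 / (1 + t\<^sup>2)"
    by (simp add: divide_simps add_nonneg_eq_0_iff) (simp add: power2_eq_square algebra_simps)
  also have "\<dots> \<le> 1 - (1 - sqrt \<rho>)\<^sup>2 / 2"
  proof -
    have "t\<^sup>2 \<le> 1" using t t1 by (simp add: power_le_one)
    moreover have "(1 - sqrt \<rho>)\<^sup>2 \<le> (1 - t)\<^sup>2" using t t1 by (intro power_mono) auto
    ultimately have "(1 - sqrt \<rho>)\<^sup>2 / 2 \<le> (1 - t)\<^sup>2 / (1 + t\<^sup>2)"
      by (intro frac_le) (auto intro: add_pos_nonneg)
    then show ?thesis by simp
  qed
  finally show ?thesis .
qed

section \<open>Maps of simply connected compacta into plane domains\<close>

text \<open>A stage of the iteration: a covering of \<open>\<Omega>\<close> by \<open>U\<close>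
together with the lift \<open>h\<close> of the given map \<open>f\<close>, normalised so that the
base point \<open>s\<close> is sent to \<open>0\<close>.\<close>

definition disc_lift ::
  "complex set \<Rightarrow> 'a::real_normed_vector set \<Rightarrow> 'a \<Rightarrow> ('a \<Rightarrow> complex) \<Rightarrow>
   complex set \<Rightarrow> (complex \<Rightarrow> complex) \<Rightarrow> ('a \<Rightarrow> complex) \<Rightarrow> bool" where
  "disc_lift \<Omega> S s f U P h \<longleftrightarrow> disc_cover \<Omega> U P \<and> P 0 = 0 \<and>
     continuous_on S h \<and> h \<in> S \<rightarrow> U \<and> h s = 0 \<and> (\<forall>x\<in>S. P (h x) = f x)"

lemma disc_lift_koebe:
  assumes lift: "disc_lift \<Omega> S s f U P h"
    and S: "simply_connected S" "locally path_connected S" "s \<in> S"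
    and b: "norm b < 1" "- (b\<^sup>2) \<notin> U"
  obtains h' where "disc_lift \<Omega> S s f {z \<in> ball 0 1. koebe b z \<in> U} (P \<circ> koebe b) h'"
    "deriv (P \<circ> koebe b) 0 = deriv P 0 * deriv (koebe b) 0"
proof -
  have cov: "disc_cover \<Omega> U P" "P 0 = 0" and h: "continuous_on S h" "h \<in> S \<rightarrow> U" "h s = 0"
    "\<forall>x\<in>S. P (h x) = f x"
    using lift by (auto simp: disc_lift_def)
  have U: "open U" "U \<subseteq> ball 0 1" "P holomorphic_on U"
    using cov by (auto simp: disc_cover_def)
  have U0: "0 \<in> U" using h S(3) by (auto simp: Pi_iff)
  have "h \<in> S \<rightarrow> ball 0 1 - {- (b\<^sup>2)}"
  proof
    fix x assume "x \<in> S"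
    then have "h x \<in> U" using h(2) by blast
    then show "h x \<in> ball 0 1 - {- (b\<^sup>2)}" using U(2) b(2) by auto
  qed
  then obtain h' where h': "continuous_on S h'" "h' \<in> S \<rightarrow> ball 0 1" "\<And>x. x \<in> S \<Longrightarrow> koebe b (h' x) = h x" "h' s = 0"
    using koebe_lift_continuous[OF b(1) S(1,2) h(1) _ S(3), of 0] h(3) by (auto simp: koebe_0)
  show ?thesis
  proof
    show "disc_lift \<Omega> S s f {z \<in> ball 0 1. koebe b z \<in> U} (P \<circ> koebe b) h'"
      unfolding disc_lift_def using disc_cover_koebe[OF cov(1) b] h' h(2,4) cov(2)
      by (auto simp: koebe_0 Pi_iff)
    have "(koebe b has_field_derivative deriv (koebe b) 0) (at 0)"
      using koebe_holomorphic[OF b(1)] by (rule holomorphic_derivI) auto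
    moreover have "(P has_field_derivative deriv P 0) (at (koebe b 0))"
      unfolding koebe_0 using U(3,1) U0 by (rule holomorphic_derivI)
    ultimately show "deriv (P \<circ> koebe b) 0 = deriv P 0 * deriv (koebe b) 0"
      by (intro DERIV_imp_deriv DERIV_chain)
  qed
qed

text \<open>A section over the ball of radius \<open>e\<close> maps it into the unit disc, so its
derivative is at most \<open>1/e\<close>, and it is inverse to that of the covering. The bound
does not depend on the stage; it stops the iteration.\<close>

lemma disc_lift_deriv_lower_bound:
  assumes lift: "disc_lift \<Omega> S s f U P h" and s: "s \<in> S" and e: "0 < e" "ball 0 e \<subseteq> \<Omega>"
  shows "e \<le> norm (deriv P 0)"
proof -
  have cov: "disc_cover \<Omega> U P" "P 0 = 0" and U0: "0 \<in> U"
    using lift s by (auto simp: disc_lift_def Pi_iff)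
  have e': "ball (P 0) e \<subseteq> \<Omega>" using cov e by simp
  obtain v where v: "v holomorphic_on ball 0 e" "v \<in> ball 0 e \<rightarrow> U" "v 0 = 0"
    "deriv P 0 * deriv v 0 = 1"
    using disc_cover_deriv[OF cov(1) U0 e(1) e'] cov(2) by metis
  define w where "w \<equiv> v \<circ> (\<lambda>z. of_real e * z)"
  have map: "of_real e * z \<in> ball 0 e" if "norm z < 1" for z :: complex
    using that e(1) by (simp add: norm_mult)
  have "w holomorphic_on ball 0 1"
    unfolding w_def using map
    by (intro holomorphic_on_compose holomorphic_on_subset[OF v(1)] holomorphic_intros) auto
  moreover have "w 0 = 0" by (simp add: w_def v)
  moreover have "norm (w z) < 1" if "norm z < 1" for z
  proof -
    have "v (of_real e * z) \<in> U" using map[OF that] v(2) by blast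
    then show ?thesis using cov(1) by (auto simp: w_def disc_cover_def)
  qed
  ultimately have "norm (deriv w 0) \<le> 1"
    using Schwarz_Lemma(2)[of w 0] by simp
  moreover have "deriv w 0 = deriv v 0 * of_real e"
  proof (rule DERIV_imp_deriv)
    have "(v has_field_derivative deriv v 0) (at (of_real e * 0))"
      using v(1) e(1) by (auto intro: holomorphic_derivI[of _ "ball 0 e"])
    moreover have "((\<lambda>z. of_real e * z) has_field_derivative of_real e) (at (0::complex))"
      by (auto intro!: derivative_eq_intros)
    ultimately show "(w has_field_derivative deriv v 0 * of_real e) (at 0)"
      unfolding w_def by (rule DERIV_chain)
  qed
  ultimately have "norm (deriv v 0) * e \<le> 1"
    using e(1) by (simp add: norm_mult)
  moreover have "norm (deriv P 0) * norm (deriv v 0) = 1"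
    using v(4) by (metis norm_mult norm_one)
  ultimately have "norm (deriv P 0) * (norm (deriv v 0) * e) \<le> norm (deriv P 0)"
    by (simp add: mult_left_le)
  then show ?thesis
    using \<open>norm (deriv P 0) * norm (deriv v 0) = 1\<close> by (simp flip: mult.assoc)
qed

text \<open>Near \<open>x\<close> the lift is a section over a fixed ball around
\<open>f x\<close> composed with \<open>f\<close>, so by Schwarz--Pick it moves by at most
\<open>1/2\<close> in the pseudo-hyperbolic metric, whichever stage is considered. A bound below
\<open>1\<close> at one point therefore spreads to a neighbourhood: going from \<open>y\<close> to
the centre \<open>x\<close> and on to \<open>y'\<close> uses the estimate twice.\<close>

lemma disc_lift_spread:
  fixes f :: "'a::real_normed_vector \<Rightarrow> complex"
  assumes \<Omega>: "open \<Omega>" and S: "locally path_connected S"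
    and f: "continuous_on S f" "f \<in> S \<rightarrow> \<Omega>" and x: "x \<in> S"
  shows "\<exists>T. openin (top_of_set S) T \<and> x \<in> T \<and>
    (\<forall>\<rho><1. \<exists>\<rho>'<1. \<forall>h \<in> {h. \<exists>U P. disc_lift \<Omega> S s f U P h}. \<forall>y\<in>T. \<forall>y'\<in>T.
        norm (h y) \<le> \<rho> \<longrightarrow> norm (h y') \<le> \<rho>')"
proof -
  obtain e where e: "e > 0" "ball (f x) e \<subseteq> \<Omega>"
    using f(2) x \<Omega> open_contains_ball by (metis Pi_iff)
  have "openin (top_of_set S) (S \<inter> f -` ball (f x) (e/2))"
    using f(1) by (intro continuous_openin_preimage_gen) auto
  moreover have "x \<in> S \<inter> f -` ball (f x) (e/2)" using x e by simp
  moreover have "locally connected S"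
    using S locally_mono path_connected_imp_connected by blast
  ultimately obtain T where T: "openin (top_of_set S) T" "x \<in> T" "connected T" "T \<subseteq> S \<inter> f -` ball (f x) (e/2)"
    unfolding locally_connected by meson
  define g where "g \<equiv> \<lambda>\<rho>::real. sqrt (1 - 3/4 * (1 - \<rho>)\<^sup>2)"
  have g1: "g \<rho> < 1" if "\<rho> < 1" for \<rho>
    using that by (simp add: g_def)
  have near: "norm (h y) < 1 \<and> norm (h x) < 1 \<and> norm (h y - h x) \<le> norm (1 - cnj (h x) * h y) / 2"
    if l: "disc_lift \<Omega> S s f U P h" and y: "y \<in> T" for U P h y
  proof -
    have cov: "disc_cover \<Omega> U P" and h: "continuous_on S h" "h \<in> S \<rightarrow> U" "\<forall>x\<in>S. P (h x) = f x"
      using l by (auto simp: disc_lift_def)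
    have U: "U \<subseteq> ball 0 1" using cov by (auto simp: disc_cover_def)
    have hx: "h x \<in> U" and hy: "h y \<in> U" using h x y T by auto
    have Ph: "P (h x) = f x" using h x by auto
    obtain v where v: "v holomorphic_on ball (f x) e" "v \<in> ball (f x) e \<rightarrow> U"
      "\<forall>u\<in>ball (f x) e. P (v u) = u" "v (f x) = h x"
      using cov hx e(2) unfolding disc_cover_def Ph[symmetric] by blast
    have fT: "f u \<in> ball (f x) (e/2)" "f u \<in> ball (f x) e" "u \<in> S" if "u \<in> T" for u
      using T(4) that e by auto
    have "(v \<circ> f) y = h y"
    proof (rule disc_cover_lift_unique[OF cov \<Omega> T(3), of "v \<circ> f" h])
      show "continuous_on T (v \<circ> f)"
        using fT T(4) by (intro continuous_on_compose continuous_on_subset[OF f(1)]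
          continuous_on_subset[OF holomorphic_on_imp_continuous_on[OF v(1)]]) auto
      show "continuous_on T h" using h(1) T(4) by (auto intro: continuous_on_subset)
      show "v \<circ> f \<in> T \<rightarrow> U" using v(2) fT by auto
      show "h \<in> T \<rightarrow> U" using h(2) fT by auto
      show "P ((v \<circ> f) u) = P (h u)" if "u \<in> T" for u
        using v(3) h(3) fT[OF that] by auto
    qed (use v T y in auto)
    moreover have "norm (disc_shift (v (f x)) (v (f y))) \<le> norm (f y - f x) / e"
      using v(2) U fT y by (intro Schwarz_Pick_ball v(1) e) blast+
    moreover have "norm (f y - f x) / e \<le> 1/2"
      using fT(1)[OF y] e by (simp add: dist_norm norm_minus_commute field_simps)
    then have "norm (disc_shift (v (f x)) (v (f y))) \<le> 1/2"
      using calculation(2) by linarith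
    ultimately have le: "norm (disc_shift (h x) (h y)) \<le> 1/2"
      using v(4) by simp
    have n: "norm (h x) < 1" "norm (h y) < 1" using U hx hy by auto
    have "norm (cnj (h x) * h y) < 1"
      using n norm_mult_less[of "cnj (h x)" 1 "h y" 1] by simp
    then have "1 - cnj (h x) * h y \<noteq> 0" by auto
    then have "norm (h y - h x) \<le> norm (1 - cnj (h x) * h y) / 2"
      using le by (simp add: Moebius_function_simple norm_divide field_simps)
    then show ?thesis using n by simp
  qed
  have "norm (h y') \<le> g (g \<rho>)"
    if \<rho>: "\<rho> < 1" and l: "disc_lift \<Omega> S s f U P h" and y: "y \<in> T" "y' \<in> T" "norm (h y) \<le> \<rho>" for U P h y y' \<rho>
  proof -
    note ny = near[OF l y(1)] and ny' = near[OF l y(2)]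
    have "norm (1 - cnj (h y) * h x) = norm (1 - cnj (h x) * h y)"
      by (metis complex_cnj_cnj complex_cnj_diff complex_cnj_mult complex_cnj_one complex_mod_cnj mult.commute)
    then have "norm (h x) \<le> g \<rho>"
      unfolding g_def using ny y(3) \<rho> by (intro pick_distance_bound) (auto simp: norm_minus_commute)
    then have "norm (h y') \<le> sqrt (1 - 3/4 * (1 - g \<rho>)\<^sup>2)"
      using ny' g1[OF \<rho>] by (intro pick_distance_bound) auto
    then show ?thesis
      by (simp only: g_def)
  qed
  then have "\<forall>h \<in> {h. \<exists>U P. disc_lift \<Omega> S s f U P h}. \<forall>y\<in>T. \<forall>y'\<in>T.
        norm (h y) \<le> \<rho> \<longrightarrow> norm (h y') \<le> g (g \<rho>)" if "\<rho> < 1" for \<rho>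
    using that by blast
  then show ?thesis
    using T(1,2) g1 by meson
qed

text \<open>All lifts vanish at \<open>s\<close>. Connectedness spreads this bound to every point,
and compactness makes it uniform: the lifts at all stages stay in one disc of radius less than
\<open>1\<close>.\<close>

lemma disc_lift_bounded:
  fixes f :: "'a::real_normed_vector \<Rightarrow> complex"
  assumes \<Omega>: "open \<Omega>" and S: "locally path_connected S" "connected S" "compact S" "s \<in> S"
    and f: "continuous_on S f" "f \<in> S \<rightarrow> \<Omega>"
  obtains \<rho> where "0 \<le> \<rho>" "\<rho> < 1" "\<And>U P h x. disc_lift \<Omega> S s f U P h \<Longrightarrow> x \<in> S \<Longrightarrow> norm (h x) \<le> \<rho>"
proof -
  define F where "F = {h. \<exists>U P. disc_lift \<Omega> S s f U P h}"
  have "\<forall>x\<in>S. \<exists>T. openin (top_of_set S) T \<and> x \<in> T \<and>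
    (\<forall>\<rho><1. \<exists>\<rho>'<1. \<forall>h\<in>F. \<forall>y\<in>T. \<forall>y'\<in>T. norm (h y) \<le> \<rho> \<longrightarrow> norm (h y') \<le> \<rho>')"
    unfolding F_def using disc_lift_spread[OF \<Omega> S(1) f] by (rule ballI)
  then obtain T where "\<forall>x\<in>S. openin (top_of_set S) (T x) \<and> x \<in> T x \<and>
    (\<forall>\<rho><1. \<exists>\<rho>'<1. \<forall>h\<in>F. \<forall>y\<in>T x. \<forall>y'\<in>T x. norm (h y) \<le> \<rho> \<longrightarrow> norm (h y') \<le> \<rho>')"
    by (rule bchoice[THEN exE])
  then have T: "\<And>x. x \<in> S \<Longrightarrow> openin (top_of_set S) (T x)" "\<And>x. x \<in> S \<Longrightarrow> x \<in> T x"
    and spread: "\<And>x \<rho>. x \<in> S \<Longrightarrow> \<rho> < 1 \<Longrightarrow>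
      \<exists>\<rho>'<1. \<forall>h\<in>F. \<forall>y\<in>T x. \<forall>y'\<in>T x. norm (h y) \<le> \<rho> \<longrightarrow> norm (h y') \<le> \<rho>'"
    by simp_all
  define Q where "Q \<equiv> \<lambda>x. \<exists>\<rho><1. \<forall>h\<in>F. norm (h x) \<le> (\<rho>::real)"
  have Q: "Q x" if "x \<in> S" for x
  proof (rule connected_induction_simple[OF S(2,4) that])
    show "Q s" unfolding Q_def F_def disc_lift_def by (intro exI[of _ 0]) auto
    show "\<exists>V. openin (top_of_set S) V \<and> a \<in> V \<and> (\<forall>x\<in>V. \<forall>y\<in>V. Q x \<longrightarrow> Q y)" if "a \<in> S" for a
    proof (intro exI[of _ "T a"] conjI ballI impI T[OF that])
      fix x y assume xy: "x \<in> T a" "y \<in> T a" and "Q x"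
      then obtain \<rho> where "\<rho> < 1" "\<And>h. h \<in> F \<Longrightarrow> norm (h x) \<le> (\<rho>::real)"
        unfolding Q_def by blast
      with spread[OF that, of \<rho>] xy show "Q y" unfolding Q_def by meson
    qed
  qed
  have "\<forall>x\<in>S. \<exists>\<rho><1. \<forall>h\<in>F. \<forall>y\<in>T x. norm (h y) \<le> (\<rho>::real)"
  proof
    fix x assume x: "x \<in> S"
    obtain \<rho> where "\<rho> < 1" "\<And>h. h \<in> F \<Longrightarrow> norm (h x) \<le> (\<rho>::real)"
      using Q[OF x] unfolding Q_def by blast
    with spread[OF x, of \<rho>] T(2)[OF x]
    show "\<exists>\<rho><1. \<forall>h\<in>F. \<forall>y\<in>T x. norm (h y) \<le> (\<rho>::real)"
      by meson
  qed
  then obtain r where "\<forall>x\<in>S. r x < 1 \<and> (\<forall>h\<in>F. \<forall>y\<in>T x. norm (h y) \<le> (r x::real))"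
    by (rule bchoice[THEN exE])
  then have r: "\<And>x. x \<in> S \<Longrightarrow> r x < 1"
    "\<And>x h y. x \<in> S \<Longrightarrow> h \<in> F \<Longrightarrow> y \<in> T x \<Longrightarrow> norm (h y) \<le> r x"
    by simp_all
  have "(\<forall>c\<in>T ` S. openin (top_of_set S) c) \<and> S \<subseteq> \<Union>(T ` S)"
    using T by blast
  then have "\<exists>D\<subseteq>T ` S. finite D \<and> S \<subseteq> \<Union>D"
    using S(3)[unfolded compact_eq_openin_cover, rule_format, of "T ` S"] by simp
  then obtain C where C: "C \<subseteq> S" "finite C" "S \<subseteq> \<Union>(T ` C)"
    by (metis finite_subset_image)
  show ?thesis
  proof
    let ?\<rho> = "Max (insert 0 (r ` C))"
    show "0 \<le> ?\<rho>" "?\<rho> < 1" using C r(1) by auto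
    fix U P h x assume l: "disc_lift \<Omega> S s f U P h" and "x \<in> S"
    then obtain y where y: "y \<in> C" "x \<in> T y" using C by auto
    have "h \<in> F" using l by (auto simp: F_def)
    then have "norm (h x) \<le> r y" using C y r(2) by blast
    also have "r y \<le> ?\<rho>" using C y by (intro Max_ge) auto
    finally show "norm (h x) \<le> ?\<rho>" .
  qed
qed

text \<open>As long as the covering domain omits a point of the disc of radius
\<open>\<rho>\<close> that contains all lifts, another square root covering multiplies the
derivative at the origin by at most \<open>q < 1\<close>. The lower bound for the derivative
forces this to end, and then the lift can be contracted linearly inside the covering
domain.\<close>

lemma nullhomotopic_in_disc_subset:
  fixes f :: "'a::real_normed_vector \<Rightarrow> complex"
  assumes \<Omega>: "open \<Omega>" "\<Omega> \<subseteq> ball 0 1"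
    and S: "simply_connected S" "locally path_connected S" "compact S" "s \<in> S"
    and f: "continuous_on S f" "f \<in> S \<rightarrow> \<Omega>" "f s = 0"
  shows "homotopic_with_canon (\<lambda>_. True) S \<Omega> f (\<lambda>_. 0)"
proof -
  have con: "connected S" using S(1) by (rule simply_connected_imp_connected)
  have \<Omega>0: "0 \<in> \<Omega>" using f S(4) by (metis Pi_iff)
  then obtain e where e: "e > 0" "ball 0 e \<subseteq> \<Omega>"
    using \<Omega>(1) open_contains_ball by blast
  obtain \<rho> where \<rho>: "0 \<le> \<rho>" "\<rho> < 1"
    and bound: "\<And>U P h x. disc_lift \<Omega> S s f U P h \<Longrightarrow> x \<in> S \<Longrightarrow> norm (h x) \<le> \<rho>"
    using disc_lift_bounded[OF \<Omega>(1) S(2) con S(3,4) f(1,2)] by metis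
  define q where "q \<equiv> 1 - (1 - sqrt \<rho>)\<^sup>2 / 2"
  have q: "0 \<le> q" "q < 1"
  proof -
    have "0 < 1 - sqrt \<rho>" "1 - sqrt \<rho> \<le> 1" using \<rho> by auto
    then have "0 < (1 - sqrt \<rho>)\<^sup>2" "(1 - sqrt \<rho>)\<^sup>2 \<le> 1" by (auto intro: power_le_one)
    then show "0 \<le> q" "q < 1" by (auto simp: q_def)
  qed
  have step: "(\<exists>U P h. disc_lift \<Omega> S s f U P h \<and> cball 0 \<rho> \<subseteq> U) \<or>
      (\<exists>U P h. disc_lift \<Omega> S s f U P h \<and> norm (deriv P 0) \<le> q ^ n)" for n
  proof (induction n)
    case 0
    have "disc_lift \<Omega> S s f \<Omega> (\<lambda>z. z) f"
      using disc_cover_id[OF \<Omega>] f by (simp add: disc_lift_def)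
    then show ?case by (intro disjI2 exI conjI) auto
  next
    case (Suc n)
    show ?case
    proof (cases "\<exists>U P h. disc_lift \<Omega> S s f U P h \<and> cball 0 \<rho> \<subseteq> U")
      case False
      then obtain U P h where l: "disc_lift \<Omega> S s f U P h" "norm (deriv P 0) \<le> q ^ n"
        using Suc by blast
      then obtain a where a: "norm a \<le> \<rho>" "a \<notin> U"
        using False by (auto simp: subset_iff)
      \<comment> \<open>The branch value \<open>- b\<^sup>2\<close> is then the omitted point \<open>a\<close>.\<close>
      define b where "b = csqrt (- a)"
      have b2: "b\<^sup>2 = - a" by (simp add: b_def)
      then have nb: "(norm b)\<^sup>2 \<le> \<rho>" using a by (metis norm_minus_cancel norm_power)
      then have nb1: "norm b < 1"
        using \<rho> by (metis less_le_trans linorder_not_le norm_ge_zero one_le_power order_less_irrefl)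
      obtain h' where h': "disc_lift \<Omega> S s f {z \<in> ball 0 1. koebe b z \<in> U} (P \<circ> koebe b) h'"
          "deriv (P \<circ> koebe b) 0 = deriv P 0 * deriv (koebe b) 0"
        using disc_lift_koebe[OF l(1) S(1,2,4) nb1] b2 a by auto
      have "norm (deriv (koebe b) 0) \<le> q"
        unfolding q_def using nb \<rho>(2) by (rule koebe_contraction_factor)
      then have "norm (deriv (P \<circ> koebe b) 0) \<le> q ^ n * q"
        unfolding h'(2) norm_mult using l(2) q by (intro mult_mono) auto
      then show ?thesis using h'(1) by (auto simp: mult.commute)
    qed auto
  qed
  obtain n where "q ^ n < e"
    using q e real_arch_pow_inv by blast
  then have "\<not> (\<exists>U P h. disc_lift \<Omega> S s f U P h \<and> norm (deriv P 0) \<le> q ^ n)"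
    using disc_lift_deriv_lower_bound[OF _ S(4) e] by fastforce
  then obtain U P h where l: "disc_lift \<Omega> S s f U P h" and U: "cball 0 \<rho> \<subseteq> U"
    using step[of n] by blast
  have P: "continuous_on U P" "P \<in> U \<rightarrow> \<Omega>" "P 0 = 0"
    using l by (auto simp: disc_lift_def disc_cover_def holomorphic_on_imp_continuous_on)
  have h: "continuous_on S h" "h \<in> S \<rightarrow> U" "\<forall>x\<in>S. P (h x) = f x"
    using l by (auto simp: disc_lift_def)
  have "homotopic_with_canon (\<lambda>_. True) S U h (\<lambda>_. 0)"
  proof (rule homotopic_with_linear)
    fix x assume "x \<in> S"
    then have "h x \<in> cball 0 \<rho>" using bound[OF l] by simp
    then show "closed_segment (h x) 0 \<subseteq> U"
      using U \<rho> by (meson centre_in_cball closed_segment_subset convex_cball order_trans)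
  qed (use h in auto)
  then have "homotopic_with_canon (\<lambda>_. True) S \<Omega> (P \<circ> h) (P \<circ> (\<lambda>_. 0))"
    using P by (intro homotopic_with_compose_continuous_left) auto
  then show ?thesis
    by (rule homotopic_with_eq) (use h P in auto)
qed

text \<open>Only a bounded part of \<open>\<Omega>\<close> matters, because the image of
\<open>f\<close> is compact; an affine map moves that part into the unit disc. For
\<open>S\<close> a 2-sphere this says that the second homotopy group of a plane domain
vanishes.\<close>

theorem planar_nullhomotopic:
  fixes f :: "'a::real_normed_vector \<Rightarrow> complex"
  assumes \<Omega>: "open \<Omega>"
    and S: "simply_connected S" "locally path_connected S" "compact S"
    and f: "continuous_on S f" "f \<in> S \<rightarrow> \<Omega>"
  shows "\<exists>c. homotopic_with_canon (\<lambda>_. True) S \<Omega> f (\<lambda>_. c)"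
proof (cases "S = {}")
  case True
  then show ?thesis by (simp add: homotopic_on_emptyI)
next
  case False
  then obtain s where s: "s \<in> S" by blast
  have "bounded (f ` S)"
    using f(1) S(3) by (intro compact_imp_bounded compact_continuous_image)
  then obtain R where R: "R > 0" "f ` S \<subseteq> ball (f s) R"
    using bounded_subset_ballD by blast
  define j where "j \<equiv> \<lambda>z. f s + of_real R * z"
  \<comment> \<open>The part of \<open>\<Omega>\<close> near the image of \<open>f\<close>, rescaled into the unit disc.\<close>
  define W where "W \<equiv> ball 0 1 \<inter> j -` \<Omega>"
  define g where "g \<equiv> \<lambda>x. (f x - f s) / of_real R"
  have jg: "j (g x) = f x" for x using R by (simp add: j_def g_def)
  have contj: "continuous_on A j" for A unfolding j_def by (intro continuous_intros)
  have "open W"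
    unfolding W_def using \<Omega> contj by (intro continuous_open_preimage) auto
  moreover have "W \<subseteq> ball 0 1" by (auto simp: W_def)
  moreover have "continuous_on S g"
    unfolding g_def using R by (intro continuous_intros f) auto
  moreover have "g \<in> S \<rightarrow> W"
  proof
    fix x assume x: "x \<in> S"
    then have "norm (f x - f s) < R" using R by (auto simp: dist_norm norm_minus_commute)
    then show "g x \<in> W" using f x R jg[of x] by (auto simp: W_def norm_divide g_def)
  qed
  moreover have "g s = 0" by (simp add: g_def)
  ultimately have "homotopic_with_canon (\<lambda>_. True) S W g (\<lambda>_. 0)"
    using S s by (intro nullhomotopic_in_disc_subset) auto
  then have "homotopic_with_canon (\<lambda>_. True) S \<Omega> (j \<circ> g) (j \<circ> (\<lambda>_. 0))"
    using contj by (intro homotopic_with_compose_continuous_left) (auto simp: W_def)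
  then have "homotopic_with_canon (\<lambda>_. True) S \<Omega> f (\<lambda>_. j 0)"
    by (rule homotopic_with_eq) (auto simp: jg)
  then show ?thesis by blast
qed

section \<open>Lifting to the plane\<close>

text \<open>The universal covering of the torus by the complex plane. Its periods are the numbers
\<open>z\<close> with \<open>wrap z = (1, 1)\<close>.\<close>

definition wrap :: "complex \<Rightarrow> complex \<times> complex" where
  "wrap z = (cis (Re z), cis (Im z))"

definition torus_mult :: "complex \<times> complex \<Rightarrow> complex \<times> complex \<Rightarrow> complex \<times> complex" where
  "torus_mult \<tau> z = (fst \<tau> * fst z, snd \<tau> * snd z)"

lemma wrap_add: "wrap (x + y) = torus_mult (wrap x) (wrap y)"
  by (simp add: wrap_def torus_mult_def cis_mult)

lemma wrap_in_torus [simp]: "wrap z \<in> torus"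
  by (simp add: wrap_def torus_def)

lemma wrap_0: "wrap 0 = (1, 1)"
  by (simp add: wrap_def)

lemma wrap_eq_iff: "wrap x = wrap y \<longleftrightarrow> wrap (x - y) = (1, 1)"
  by (auto simp: wrap_def simp flip: cis_divide)

lemma continuous_on_wrap [continuous_intros]:
  "continuous_on S f \<Longrightarrow> continuous_on S (\<lambda>x. wrap (f x))"
  unfolding wrap_def by (intro continuous_intros)

lemma torus_mult_in_torus: "\<tau> \<in> torus \<Longrightarrow> z \<in> torus \<Longrightarrow> torus_mult \<tau> z \<in> torus"
  by (auto simp: torus_mult_def torus_def norm_mult)

lemma torus_mult_inject: "\<tau> \<in> torus \<Longrightarrow> torus_mult \<tau> z = torus_mult \<tau> z' \<longleftrightarrow> z = z'"
  by (auto simp: torus_mult_def torus_def prod_eq_iff)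

lemma torus_lift:
  fixes f :: "'a::real_normed_vector \<Rightarrow> complex \<times> complex"
  assumes S: "simply_connected S" "locally path_connected S"
    and f: "continuous_on S f" "f \<in> S \<rightarrow> torus"
  obtains g where "continuous_on S g" "\<And>x. x \<in> S \<Longrightarrow> f x = wrap (g x)"
proof -
  have lift: "\<exists>\<theta>. continuous_on S \<theta> \<and> (\<forall>x\<in>S. h x = cis (\<theta> x))"
    if h: "continuous_on S h" "\<And>x. x \<in> S \<Longrightarrow> norm (h x) = 1" for h :: "'a \<Rightarrow> complex"
  proof -
    obtain L where L: "continuous_on S L" "\<And>x. x \<in> S \<Longrightarrow> h x = exp (L x)"
      using continuous_logarithm_on_simply_connected[OF h(1) S] h(2) by (metis norm_zero zero_neq_one)
    have "h x = cis (Im (L x))" if "x \<in> S" for x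
    proof -
      have "Re (L x) = 0" using h(2)[OF that] L(2)[OF that] by simp
      then show ?thesis using L(2)[OF that] by (simp add: exp_eq_polar)
    qed
    moreover have "continuous_on S (\<lambda>x. Im (L x))" by (intro continuous_intros L)
    ultimately show ?thesis by blast
  qed
  have ft: "norm (fst (f x)) = 1" "norm (snd (f x)) = 1" if "x \<in> S" for x
    using f(2) that by (auto simp: torus_def Pi_iff mem_Times_iff)
  obtain \<alpha> \<beta> where ab: "continuous_on S \<alpha>" "\<forall>x\<in>S. fst (f x) = cis (\<alpha> x)"
      "continuous_on S \<beta>" "\<forall>x\<in>S. snd (f x) = cis (\<beta> x)"
    using lift[of "\<lambda>x. fst (f x)"] lift[of "\<lambda>x. snd (f x)"] ft f(1)
    by (metis continuous_on_fst continuous_on_snd)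
  show ?thesis
  proof
    show "continuous_on S (\<lambda>x. Complex (\<alpha> x) (\<beta> x))" using ab by (intro continuous_on_Complex)
    show "f x = wrap (Complex (\<alpha> x) (\<beta> x))" if "x \<in> S" for x
      using ab that by (simp add: wrap_def prod_eq_iff)
  qed
qed

text \<open>Two distinct points of the torus lift to points of the plane whose difference is not a
period, so the configuration space unwraps to the product of a plane domain and the plane.\<close>

lemma F2T_lift:
  fixes f :: "'a::real_normed_vector \<Rightarrow> torus_pair"
  assumes S: "simply_connected S" "locally path_connected S"
    and f: "continuous_on S f" "f \<in> S \<rightarrow> F2T"
  obtains u v where "continuous_on S u" "continuous_on S v"
    "\<And>x. x \<in> S \<Longrightarrow> f x = (wrap (u x), wrap (v x))"
    "\<And>x. x \<in> S \<Longrightarrow> wrap (u x - v x) \<noteq> (1, 1)"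
proof -
  have ft: "fst (f x) \<in> torus" "snd (f x) \<in> torus" "fst (f x) \<noteq> snd (f x)" if "x \<in> S" for x
  proof -
    have "f x \<in> F2T" using f(2) that by blast
    then show "fst (f x) \<in> torus" "snd (f x) \<in> torus" "fst (f x) \<noteq> snd (f x)"
      by (auto simp: conf2_def)
  qed
  obtain u where u: "continuous_on S u" "\<And>x. x \<in> S \<Longrightarrow> fst (f x) = wrap (u x)"
    using torus_lift[OF S, of "\<lambda>x. fst (f x)"] ft f(1) by (auto intro: continuous_intros)
  obtain v where v: "continuous_on S v" "\<And>x. x \<in> S \<Longrightarrow> snd (f x) = wrap (v x)"
    using torus_lift[OF S, of "\<lambda>x. snd (f x)"] ft f(1) by (auto intro: continuous_intros)
  show ?thesis
    using that[OF u(1) v(1)] u(2) v(2) ft(3) wrap_eq_iff by (metis prod.collapse)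
qed

lemma wrap_pair_in_F2T: "(wrap u, wrap v) \<in> F2T \<longleftrightarrow> wrap (u - v) \<noteq> (1, 1)"
  by (simp add: conf2_def wrap_eq_iff[of u v])

lemma open_nonperiods: "open {z. wrap z \<noteq> (1, 1)}"
  by (intro open_Collect_neq continuous_intros)

section \<open>Filling spheres\<close>

abbreviation cube :: "((real \<times> real) \<times> real) set" where
  "cube \<equiv> ({0..1} \<times> {0..1}) \<times> {0..1}"

lemma compact_cube: "compact cube" and convex_cube: "convex cube"
  by (auto intro!: compact_Times convex_Times)

lemma interior_cube: "interior cube = ({0<..<1} \<times> {0<..<1}) \<times> {0<..<1}"
  by (simp add: interior_Times interior_atLeastAtMost_real)

lemma frontier_cube: "frontier cube = {p \<in> cube. fst (fst p) \<in> {0,1} \<or> snd (fst p) \<in> {0,1} \<or> snd p \<in> {0,1}}"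
  using compact_cube by (auto simp: frontier_def interior_cube compact_imp_closed closure_closed)

text \<open>The boundary of the cube serves as the 2-sphere, because it is the natural place to
glue homotopies between maps of a square.\<close>

lemma frontier_cube_sphere:
  "simply_connected (frontier cube)" "locally path_connected (frontier cube)" "compact (frontier cube)"
proof -
  have "interior cube \<noteq> {}" by (auto simp: interior_cube intro!: exI[of _ "1/2"])
  then have "cube homeomorphic cball (0::(real \<times> real) \<times> real) 1"
    using convex_cube compact_cube by (intro homeomorphic_convex_compact_cball) auto
  then have h: "frontier cube homeomorphic sphere (0::(real \<times> real) \<times> real) 1"
    using homeomorphic_frontiers_same_dimension[of cube "cball (0::(real \<times> real) \<times> real) 1"]
      compact_cube by (simp add: compact_imp_closed)
  show "simply_connected (frontier cube)"
    unfolding homeomorphic_simply_connected_eq[OF h] by (intro simply_connected_sphere) simp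
  show "locally path_connected (frontier cube)"
    using homeomorphic_locally[OF h, of path_connected path_connected] locally_path_connected_sphere
    by (simp add: homeomorphic_path_connectedness)
  show "compact (frontier cube)"
    using compact_cube by (rule compact_frontier)
qed

lemma planar_cube_extension:
  fixes f :: "(real \<times> real) \<times> real \<Rightarrow> complex"
  assumes \<Omega>: "open \<Omega>" and f: "continuous_on (frontier cube) f" "f \<in> frontier cube \<rightarrow> \<Omega>"
  obtains g where "continuous_on cube g" "g \<in> cube \<rightarrow> \<Omega>" "\<And>p. p \<in> frontier cube \<Longrightarrow> g p = f p"
proof -
  obtain c where c: "homotopic_with_canon (\<lambda>_. True) (frontier cube) \<Omega> f (\<lambda>_. c)"
    using planar_nullhomotopic[OF \<Omega> frontier_cube_sphere f] by blast
  have "((0,0),0) \<in> frontier cube" by (simp add: frontier_cube)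
  then have c\<Omega>: "(\<lambda>_. c) \<in> cube \<rightarrow> \<Omega>"
    using homotopic_with_imp_funspace2[OF c] by auto
  have cl: "closedin (top_of_set cube) (frontier cube)"
    by (rule closed_subset[OF frontier_subset_closed[OF compact_imp_closed[OF compact_cube]] frontier_closed])
  have anr: "(ANR (frontier cube) \<and> ANR cube) \<or> ANR \<Omega>"
    using open_imp_ANR[OF \<Omega>] by blast
  have h: "homotopic_with_canon (\<lambda>_. True) (frontier cube) \<Omega> (\<lambda>_. c) f"
    using c by (simp add: homotopic_with_sym)
  show ?thesis
  proof (rule Borsuk_homotopy_extension_homotopic[OF cl anr continuous_on_const c\<Omega> h])
    fix g assume "continuous_on cube g" "g ` cube \<subseteq> \<Omega>" "\<And>p. p \<in> frontier cube \<Longrightarrow> g p = f p"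
    then show ?thesis
      by (intro that[of g]) (auto simp: image_subset_iff_funcset)
  qed
qed

text \<open>The difference of the two lifted points is extended inside the domain of non-periods,
the second point inside the whole plane.\<close>

lemma F2T_cube_extension:
  assumes f: "continuous_on (frontier cube) f" "f \<in> frontier cube \<rightarrow> F2T"
  obtains g where "continuous_on cube g" "g \<in> cube \<rightarrow> F2T" "\<And>p. p \<in> frontier cube \<Longrightarrow> g p = f p"
proof -
  obtain u v where uv: "continuous_on (frontier cube) u" "continuous_on (frontier cube) v"
    "\<And>p. p \<in> frontier cube \<Longrightarrow> f p = (wrap (u p), wrap (v p))"
    "\<And>p. p \<in> frontier cube \<Longrightarrow> wrap (u p - v p) \<noteq> (1, 1)"
    using F2T_lift[OF frontier_cube_sphere(1,2) f] by blast
  obtain d where d: "continuous_on cube d" "d \<in> cube \<rightarrow> {z. wrap z \<noteq> (1, 1)}"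
    "\<And>p. p \<in> frontier cube \<Longrightarrow> d p = u p - v p"
    using planar_cube_extension[OF open_nonperiods, of "\<lambda>p. u p - v p"] uv
    by (auto intro: continuous_on_diff)
  obtain v' where v': "continuous_on cube v'" "\<And>p. p \<in> frontier cube \<Longrightarrow> v' p = v p"
    using planar_cube_extension[OF open_UNIV uv(2)] by auto
  show ?thesis
  proof
    show "continuous_on cube (\<lambda>p. (wrap (d p + v' p), wrap (v' p)))"
      by (intro continuous_intros d v')
    show "(\<lambda>p. (wrap (d p + v' p), wrap (v' p))) \<in> cube \<rightarrow> F2T"
      using d(2) by (auto simp: wrap_pair_in_F2T Pi_iff)
    show "(wrap (d p + v' p), wrap (v' p)) = f p" if "p \<in> frontier cube" for p
      using d(3) v'(2) uv(3) that by simp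
  qed
qed

section \<open>Maps on the torus\<close>

lemma continuous_on_compact_quotient:
  fixes q :: "'a::t2_space \<Rightarrow> 'b::t2_space"
  assumes Q: "compact Q" and q: "continuous_on Q q" and F: "continuous_on Q (\<lambda>x. K (q x))"
  shows "continuous_on (q ` Q) K"
proof -
  have "closedin (top_of_set (q ` Q)) (q ` Q \<inter> K -` C)" if "closedin (top_of_set (K ` q ` Q)) C" for C
  proof -
    have "closedin (top_of_set Q) (Q \<inter> (\<lambda>x. K (q x)) -` C)"
      using F that unfolding continuous_on_closed by (metis image_image)
    then have "closedin (top_of_set (q ` Q)) (q ` (Q \<inter> (\<lambda>x. K (q x)) -` C))"
      by (rule Abstract_Topology_2.continuous_imp_closed_map[OF _ q refl Q])
    moreover have "q ` (Q \<inter> (\<lambda>x. K (q x)) -` C) = q ` Q \<inter> K -` C" by auto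
    ultimately show ?thesis by simp
  qed
  then show ?thesis unfolding continuous_on_closed by blast
qed

lemma cis_2pi_eqD:
  assumes "cis (2 * pi * x) = cis (2 * pi * y)" "x \<in> {0..1}" "y \<in> {0..1}"
  shows "x = y \<or> x = 0 \<and> y = 1 \<or> x = 1 \<and> y = 0"
proof -
  have "cos (2 * pi * x) = cos (2 * pi * y)" "sin (2 * pi * x) = sin (2 * pi * y)"
    using assms(1) by (auto simp: complex_eq_iff)
  then obtain n :: int where "2 * pi * x = 2 * pi * y + 2 * pi * n"
    using sin_cos_eq_iff[of "2 * pi * x" "2 * pi * y"] by auto
  then have "2 * pi * x = 2 * pi * (y + n)" by (simp add: algebra_simps)
  then have n: "x = y + of_int n" by simp
  then have "-1 \<le> real_of_int n" "real_of_int n \<le> 1" using assms by auto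
  then have "n = -1 \<or> n = 0 \<or> n = 1" by linarith
  then show ?thesis using n assms by auto
qed

lemma circle_quotient:
  assumes "norm c = 1" "norm d = 1"
  obtains x where "x \<in> {0..1}" "d = cis (2 * pi * x) * c"
proof
  have "norm (d / c) = 1" using assms by (simp add: norm_divide)
  then have "d / c = cis (Arg2pi (d / c))"
    using Arg2pi_eq[of "d / c"] by (simp add: cis_conv_exp)
  then have "d = cis (Arg2pi (d / c)) * c"
    using assms by (metis nonzero_divide_eq_eq norm_zero zero_neq_one)
  then show "d = cis (2 * pi * (Arg2pi (d / c) / (2 * pi))) * c" by simp
  show "Arg2pi (d / c) / (2 * pi) \<in> {0..1}"
    using Arg2pi_ge_0[of "d / c"] Arg2pi_lt_2pi[of "d / c"] by simp
qed

text \<open>When every map of a 2-sphere into \<open>Y\<close> extends over the ball, maps of the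
torus are determined up to homotopy by their loops along the meridian and the longitude. Cut open,
the torus is a square; the two maps fill the bottom and top of a cube, and the given path
homotopies fill its sides, opposite sides carrying the same homotopy. The extension over the cube
therefore descends to the product of an interval with the torus.\<close>

lemma torus_maps_homotopic:
  fixes f g :: "complex \<times> complex \<Rightarrow> 'b::real_normed_vector"
  assumes fill: "\<And>b. continuous_on (frontier cube) b \<Longrightarrow> b \<in> frontier cube \<rightarrow> Y \<Longrightarrow>
      \<exists>F. continuous_on cube F \<and> F \<in> cube \<rightarrow> Y \<and> (\<forall>p\<in>frontier cube. F p = b p)"
    and f: "continuous_on torus f" "f \<in> torus \<rightarrow> Y" and g: "continuous_on torus g" "g \<in> torus \<rightarrow> Y"
    and z: "z \<in> torus"
    and mer: "homotopic_paths Y (f \<circ> meridian z) (g \<circ> meridian z)"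
    and lon: "homotopic_paths Y (f \<circ> longitude z) (g \<circ> longitude z)"
  shows "homotopic_with_canon (\<lambda>_. True) torus Y f g"
proof -
  define I where "I = {0..1::real}"
  define e where "e \<equiv> \<lambda>p::real \<times> real. (cis (2 * pi * fst p) * fst z, cis (2 * pi * snd p) * snd z)"
  have z1: "norm (fst z) = 1" "norm (snd z) = 1" using z by (auto simp: torus_def)
  have e_torus: "e p \<in> torus" for p using z1 by (simp add: e_def torus_def norm_mult)
  have e_cont: "continuous_on A (\<lambda>x. e (k x))" if "continuous_on A k" for A :: "((real \<times> real) \<times> real) set" and k
    unfolding e_def using that by (intro continuous_intros)
  have e_edge: "e (x, 0) = meridian z x" "e (x, 1) = meridian z x" "e (0, x) = longitude z x"
    "e (1, x) = longitude z x" for x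
    by (simp_all add: e_def meridian_def longitude_def)
  have base: "meridian z 0 = z" "meridian z 1 = z" "longitude z 0 = z" "longitude z 1 = z"
    by (simp_all add: meridian_def longitude_def)
  obtain m where m: "continuous_on (I \<times> I) m" "m \<in> I \<times> I \<rightarrow> Y"
    "\<forall>x\<in>I. m (0, x) = f (meridian z x)" "\<forall>x\<in>I. m (1, x) = g (meridian z x)"
    "\<forall>t\<in>I. m (t, 0) = f z \<and> m (t, 1) = f z"
    using mer unfolding homotopic_paths by (auto simp: pathstart_def pathfinish_def base I_def image_subset_iff_funcset)
  obtain l where l: "continuous_on (I \<times> I) l" "l \<in> I \<times> I \<rightarrow> Y"
    "\<forall>x\<in>I. l (0, x) = f (longitude z x)" "\<forall>x\<in>I. l (1, x) = g (longitude z x)"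
    "\<forall>t\<in>I. l (t, 0) = f z \<and> l (t, 1) = f z"
    using lon unfolding homotopic_paths by (auto simp: pathstart_def pathfinish_def base I_def image_subset_iff_funcset)
  \<comment> \<open>The height \<open>snd p\<close> is the time of the homotopy; the sides carry \<open>m\<close> and \<open>l\<close>.\<close>
  define b where "b \<equiv> \<lambda>p. if snd p = 0 then f (e (fst p)) else if snd p = 1 then g (e (fst p))
    else if snd (fst p) = 0 \<or> snd (fst p) = 1 then m (snd p, fst (fst p)) else l (snd p, snd (fst p))"
  define X where "X = {p\<in>cube. fst (fst p) = 0 \<or> fst (fst p) = 1}"
  define Z where "Z = {p\<in>cube. snd (fst p) = 0 \<or> snd (fst p) = 1}"
  define T0 where "T0 = {p\<in>cube. snd p = 0}"
  define T1 where "T1 = {p\<in>cube. snd p = 1}"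
  have fr: "frontier cube = T0 \<union> (T1 \<union> (Z \<union> X))"
    unfolding frontier_cube X_def Z_def T0_def T1_def by auto
  have cl: "closed X" "closed Z" "closed T0" "closed T1"
  proof -
    have "X = cube \<inter> {p. fst (fst p) = 0 \<or> fst (fst p) = 1}" "Z = cube \<inter> {p. snd (fst p) = 0 \<or> snd (fst p) = 1}"
      "T0 = cube \<inter> {p. snd p = 0}" "T1 = cube \<inter> {p. snd p = 1}"
      by (auto simp: X_def Z_def T0_def T1_def)
    then show "closed X" "closed Z" "closed T0" "closed T1"
      using compact_imp_closed[OF compact_cube]
      by (auto intro!: closed_Int closed_Collect_disj closed_Collect_eq continuous_intros)
  qed
  have c1: "continuous_on (Z \<union> X) (\<lambda>p. if snd (fst p) = 0 \<or> snd (fst p) = 1 then m (snd p, fst (fst p))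
      else l (snd p, snd (fst p)))"
  proof (rule continuous_on_cases[OF cl(2,1)])
    show "continuous_on Z (\<lambda>p. m (snd p, fst (fst p)))"
      by (rule continuous_on_compose2[OF m(1)]) (auto intro!: continuous_intros simp: Z_def I_def)
    show "continuous_on X (\<lambda>p. l (snd p, snd (fst p)))"
      by (rule continuous_on_compose2[OF l(1)]) (auto intro!: continuous_intros simp: X_def I_def)
  qed (use m l in \<open>auto simp: X_def Z_def I_def\<close>)
  have c2: "continuous_on (T1 \<union> (Z \<union> X)) (\<lambda>p. if snd p = 1 then g (e (fst p)) else
     if snd (fst p) = 0 \<or> snd (fst p) = 1 then m (snd p, fst (fst p)) else l (snd p, snd (fst p)))"
  proof (rule continuous_on_cases[OF cl(4) _ _ c1])
    show "continuous_on T1 (\<lambda>p. g (e (fst p)))"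
      by (rule continuous_on_compose2[OF g(1)]) (auto intro!: e_cont continuous_intros simp: e_torus)
  qed (use m l cl in \<open>auto simp: X_def Z_def T1_def I_def e_edge\<close>)
  have "continuous_on (frontier cube) b"
    unfolding fr b_def
  proof (rule continuous_on_cases[OF cl(3) _ _ c2])
    show "continuous_on T0 (\<lambda>p. f (e (fst p)))"
      by (rule continuous_on_compose2[OF f(1)]) (auto intro!: e_cont continuous_intros simp: e_torus)
  qed (use m l cl in \<open>auto simp: X_def Z_def T0_def T1_def I_def e_edge\<close>)
  moreover have "b \<in> frontier cube \<rightarrow> Y"
    using f(2) g(2) m(2) l(2) e_torus unfolding fr
    by (auto simp: b_def X_def Z_def T0_def T1_def I_def Pi_iff)
  ultimately obtain F where F: "continuous_on cube F" "F \<in> cube \<rightarrow> Y" "\<And>p. p \<in> frontier cube \<Longrightarrow> F p = b p"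
    using fill by metis
  have b_t: "F ((x, y), 0) = f (e (x, y))" "F ((x, y), 1) = g (e (x, y))" if "x \<in> I" "y \<in> I" for x y
    using that F(3)[of "((x, y), 0)"] F(3)[of "((x, y), 1)"] by (auto simp: frontier_cube b_def I_def)
  have F_x: "F ((0, y), t) = F ((1, y), t)" if "y \<in> I" "t \<in> I" for y t
    using that F(3)[of "((0, y), t)"] F(3)[of "((1, y), t)"] m(5) l(5)
    by (auto simp: frontier_cube b_def I_def e_edge)
  have F_y: "F ((x, 0), t) = F ((x, 1), t)" if "x \<in> I" "t \<in> I" for x t
    using that F(3)[of "((x, 0), t)"] F(3)[of "((x, 1), t)"]
    by (auto simp: frontier_cube b_def I_def e_edge)
  have F_eq: "F ((x, y), t) = F ((x', y'), t)"
    if "e (x, y) = e (x', y')" "x \<in> I" "y \<in> I" "x' \<in> I" "y' \<in> I" "t \<in> I" for x y x' y' t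
  proof -
    have "fst z \<noteq> 0" "snd z \<noteq> 0" using z1 by auto
    then have "cis (2 * pi * x) = cis (2 * pi * x')" "cis (2 * pi * y) = cis (2 * pi * y')"
      using that(1) by (auto simp: e_def)
    then have "x = x' \<or> x = 0 \<and> x' = 1 \<or> x = 1 \<and> x' = 0" "y = y' \<or> y = 0 \<and> y' = 1 \<or> y = 1 \<and> y' = 0"
      using that cis_2pi_eqD unfolding I_def by blast+
    then have "F ((x, y), t) = F ((x', y), t)" "F ((x', y), t) = F ((x', y'), t)"
      using F_x F_y that by auto
    then show ?thesis by simp
  qed
  define q where "q \<equiv> \<lambda>p::(real \<times> real) \<times> real. (snd p, e (fst p))"
  define K where "K \<equiv> \<lambda>y. F (SOME p. p \<in> cube \<and> q p = y)"
  have Kq: "K (q p) = F p" if p: "p \<in> cube" for p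
  proof -
    define p' where "p' = (SOME p'. p' \<in> cube \<and> q p' = q p)"
    have p': "p' \<in> cube \<and> q p' = q p"
      unfolding p'_def by (rule someI[of _ p]) (use p in auto)
    obtain x y t x' y' t' where c: "p = ((x, y), t)" "p' = ((x', y'), t')"
      by (metis prod.collapse)
    have "F p' = F p"
      using F_eq[of x' y' x y t] p p' by (auto simp: c q_def I_def)
    then show ?thesis unfolding K_def p'_def .
  qed
  have e_surj: "\<exists>x\<in>I. \<exists>y\<in>I. e (x, y) = w" if w: "w \<in> torus" for w
  proof -
    have "norm (fst w) = 1" "norm (snd w) = 1" using w by (auto simp: torus_def)
    then obtain x y where "x \<in> I" "fst w = cis (2 * pi * x) * fst z" "y \<in> I" "snd w = cis (2 * pi * y) * snd z"
      unfolding I_def using circle_quotient z1 by metis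
    then show ?thesis
      by (auto simp: e_def prod_eq_iff)
  qed
  have q_img: "q ` cube = {0..1} \<times> torus"
  proof
    show "q ` cube \<subseteq> {0..1} \<times> torus" using e_torus by (auto simp: q_def)
    show "{0..1} \<times> torus \<subseteq> q ` cube"
    proof
      fix y :: "real \<times> complex \<times> complex" assume "y \<in> {0..1} \<times> torus"
      then have "snd y \<in> torus" "fst y \<in> {0..1}" by (auto simp: mem_Times_iff)
      moreover from this obtain x1 x2 where "x1 \<in> I" "x2 \<in> I" "e (x1, x2) = snd y"
        using e_surj by blast
      ultimately show "y \<in> q ` cube"
        by (intro image_eqI[of _ _ "((x1, x2), fst y)"]) (auto simp: q_def I_def)
    qed
  qed
  have qc: "continuous_on cube q" unfolding q_def by (intro continuous_intros e_cont)
  have "continuous_on cube (\<lambda>p. K (q p))"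
    using F(1) Kq by (subst continuous_on_cong[OF refl]) auto
  then have "continuous_on ({0..1} \<times> torus) K"
    unfolding q_img[symmetric] by (rule continuous_on_compact_quotient[OF compact_cube qc])
  moreover have "K ` ({0..1} \<times> torus) \<subseteq> Y"
    unfolding q_img[symmetric] using Kq F(2) by auto
  moreover have "K (0, w) = f w" "K (1, w) = g w" if w: "w \<in> torus" for w
  proof -
    obtain x y where xy: "x \<in> I" "y \<in> I" "e (x, y) = w" using e_surj[OF w] by blast
    show "K (0, w) = f w" "K (1, w) = g w"
      using Kq[of "((x, y), 0)"] Kq[of "((x, y), 1)"] b_t[OF xy(1,2)] xy by (auto simp: q_def I_def)
  qed
  ultimately have "homotopic_with_canon (\<lambda>_. True) torus Y (\<lambda>w. K (0, w)) (\<lambda>w. K (1, w))"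
    unfolding homotopic_with_def by (intro exI[of _ K]) (auto simp: image_subset_iff_funcset)
  then show ?thesis
    by (rule homotopic_with_eq) (use \<open>\<And>w. w \<in> torus \<Longrightarrow> K (0, w) = f w\<close> \<open>\<And>w. w \<in> torus \<Longrightarrow> K (1, w) = g w\<close> in auto)
qed

section \<open>Classes of lines in periodic families\<close>

text \<open>If \<open>\<Psi>\<close> is invariant under translation by \<open>v\<close>, the
segment from \<open>0\<close> to \<open>v\<close> gives a loop. In a vector space segments can be
replaced by broken lines, so its class depends additively on the period \<open>v\<close>. This
evaluates all products and powers in the braid group at once.\<close>

definition line_class ::
  "'b::topological_space set \<Rightarrow> ('v::real_normed_vector \<Rightarrow> 'b) \<Rightarrow> 'v \<Rightarrow> (real \<Rightarrow> 'b) set" where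
  "line_class Y \<Psi> v = path_class Y (\<lambda>t. \<Psi> (t *\<^sub>R v))"

lemma line_loop:
  fixes \<Psi> :: "'v::real_normed_vector \<Rightarrow> 'b::topological_space"
  assumes \<Psi>: "continuous_on UNIV \<Psi>" "range \<Psi> \<subseteq> Y" and v: "\<And>x. \<Psi> (x + v) = \<Psi> x"
  shows "(\<lambda>t. \<Psi> (t *\<^sub>R v)) \<in> loops_at Y (\<Psi> 0)"
proof -
  have "continuous_on {0..1} (\<lambda>t::real. \<Psi> (t *\<^sub>R v))"
    by (rule continuous_on_compose2[OF \<Psi>(1)]) (auto intro!: continuous_intros)
  moreover have "\<Psi> v = \<Psi> 0" using v[of 0] by simp
  ultimately show ?thesis
    using \<Psi>(2) by (auto simp: loops_at_def path_def path_image_def pathstart_def pathfinish_def)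
qed

lemma line_class_add:
  fixes \<Psi> :: "'v::real_normed_vector \<Rightarrow> 'b::topological_space"
  assumes \<Psi>: "continuous_on UNIV \<Psi>" "range \<Psi> \<subseteq> Y"
    and v: "\<And>x. \<Psi> (x + v) = \<Psi> x" and w: "\<And>x. \<Psi> (x + w) = \<Psi> x"
  shows "line_class Y \<Psi> (v + w) = line_class Y \<Psi> v \<otimes>\<^bsub>pi1 Y (\<Psi> 0)\<^esub> line_class Y \<Psi> w"
proof -
  have "homotopic_paths UNIV (linepath 0 (v + w)) (linepath 0 v +++ linepath v (v + w))"
    by (rule homotopic_paths_linear) auto
  then have "homotopic_paths Y (\<Psi> \<circ> linepath 0 (v + w)) (\<Psi> \<circ> (linepath 0 v +++ linepath v (v + w)))"
    using \<Psi> by (intro homotopic_paths_continuous_image) auto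
  also have "\<Psi> \<circ> (linepath 0 v +++ linepath v (v + w)) = (\<lambda>t. \<Psi> (t *\<^sub>R v)) +++ (\<lambda>t. \<Psi> (t *\<^sub>R w))"
  proof -
    have "\<Psi> (linepath v (v + w) t) = \<Psi> (t *\<^sub>R w)" for t
      using v[of "t *\<^sub>R w"] by (simp add: linepath_def algebra_simps)
    then have "\<Psi> \<circ> linepath v (v + w) = (\<lambda>t. \<Psi> (t *\<^sub>R w))" by auto
    moreover have "\<Psi> \<circ> linepath 0 v = (\<lambda>t. \<Psi> (t *\<^sub>R v))" by (auto simp: linepath_def)
    ultimately show ?thesis by (simp only: path_compose_join)
  qed
  finally have "path_class Y (\<Psi> \<circ> linepath 0 (v + w)) =
      path_class Y ((\<lambda>t. \<Psi> (t *\<^sub>R v)) +++ (\<lambda>t. \<Psi> (t *\<^sub>R w)))"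
    by (rule path_class_eq)
  moreover have "\<Psi> \<circ> linepath 0 (v + w) = (\<lambda>t. \<Psi> (t *\<^sub>R (v + w)))"
    by (simp add: comp_def linepath_def)
  ultimately show ?thesis
    unfolding line_class_def pi1_mult[OF line_loop[OF \<Psi> v] line_loop[OF \<Psi> w]] by simp
qed

lemma line_class_of_int:
  fixes \<Psi> :: "'v::real_normed_vector \<Rightarrow> 'b::real_normed_vector"
  assumes \<Psi>: "continuous_on UNIV \<Psi>" "range \<Psi> \<subseteq> Y" and v: "\<And>x. \<Psi> (x + v) = \<Psi> x"
  shows "(\<forall>x. \<Psi> (x + of_int n *\<^sub>R v) = \<Psi> x) \<and>
    line_class Y \<Psi> (of_int n *\<^sub>R v) = line_class Y \<Psi> v [^]\<^bsub>pi1 Y (\<Psi> 0)\<^esub> n"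
proof -
  let ?G = "pi1 Y (\<Psi> 0)"
  interpret group ?G using \<Psi>(2) by (intro group_pi1) auto
  have car: "line_class Y \<Psi> u \<in> carrier ?G" if "\<And>x. \<Psi> (x + u) = \<Psi> x" for u
    using line_loop[OF \<Psi> that] by (simp add: line_class_def carrier_pi1)
  have zero: "line_class Y \<Psi> 0 = \<one>\<^bsub>?G\<^esub>"
    by (simp add: line_class_def pi1_def)
  have nat: "(\<forall>x. \<Psi> (x + real k *\<^sub>R v) = \<Psi> x) \<and>
    line_class Y \<Psi> (real k *\<^sub>R v) = line_class Y \<Psi> v [^]\<^bsub>?G\<^esub> k" for k
  proof (induction k)
    case 0
    then show ?case by (simp add: zero)
  next
    case (Suc k)
    have eq: "real (Suc k) *\<^sub>R v = real k *\<^sub>R v + v" by (simp add: algebra_simps)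
    have "\<Psi> (x + (real k *\<^sub>R v + v)) = \<Psi> x" for x
      using v[of "x + real k *\<^sub>R v"] Suc by (simp add: add.assoc)
    then show ?case
      unfolding eq using line_class_add[OF \<Psi>, of "real k *\<^sub>R v" v] Suc v by simp
  qed
  show ?thesis
  proof (cases "n \<ge> 0")
    case True
    then show ?thesis using nat[of "nat n"] by (simp flip: int_pow_int)
  next
    case False
    define k where "k = nat (- n)"
    have n: "n = - int k" using False by (simp add: k_def)
    have per: "\<Psi> (x + of_int n *\<^sub>R v) = \<Psi> x" for x
    proof -
      have "\<Psi> ((x + of_int n *\<^sub>R v) + real k *\<^sub>R v) = \<Psi> (x + of_int n *\<^sub>R v)"
        using nat[of k] by blast
      then show ?thesis by (simp add: n)
    qed
    have "line_class Y \<Psi> (of_int n *\<^sub>R v) \<otimes>\<^bsub>?G\<^esub> line_class Y \<Psi> (real k *\<^sub>R v) = \<one>\<^bsub>?G\<^esub>"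
      using line_class_add[OF \<Psi>, of "of_int n *\<^sub>R v" "real k *\<^sub>R v"] per nat[of k] zero
      by (simp add: n)
    then have "inv\<^bsub>?G\<^esub> line_class Y \<Psi> (real k *\<^sub>R v) = line_class Y \<Psi> (of_int n *\<^sub>R v)"
      using car per nat[of k] car[OF v] by (intro inv_equality) auto
    then show ?thesis using per nat[of k] car[OF v] by (simp add: n int_pow_neg int_pow_int)
  qed
qed

section \<open>Smooth loops and negligible curves\<close>

text \<open>The lifted path is replaced by a nearby polynomial path with the same ends.
Differentiability is needed so that the curves to be avoided later are negligible in the
plane.\<close>

lemma F2T_smooth_loop:
  assumes "w \<in> carrier (P2T z)"
  obtains p P1 P2 where "p \<in> loops_at F2T z" "w = path_class F2T p"
    "P1 differentiable_on {0..1}" "P2 differentiable_on {0..1}"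
    "\<And>t. t \<in> {0..1} \<Longrightarrow> p t = (wrap (P1 t), wrap (P2 t))"
proof -
  obtain p0 where p0: "p0 \<in> loops_at F2T z" "w = path_class F2T p0"
    using assms by (auto simp: carrier_pi1)
  have I: "simply_connected {0..1::real}" "locally path_connected {0..1::real}"
    by (auto intro!: convex_imp_simply_connected convex_imp_locally_path_connected)
  obtain u v where uv: "continuous_on {0..1} u" "continuous_on {0..1} v"
    "\<And>t. t \<in> {0..1} \<Longrightarrow> p0 t = (wrap (u t), wrap (v t))"
    "\<And>t. t \<in> {0..1} \<Longrightarrow> wrap (u t - v t) \<noteq> (1, 1)"
    using F2T_lift[OF I, of p0] p0(1) unfolding loops_at_def path_def path_image_def by blast
  define \<Omega> where "\<Omega> = {x :: complex \<times> complex. wrap (fst x - snd x) \<noteq> (1, 1)}"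
  define E where "E \<equiv> \<lambda>x. (wrap (fst x), wrap (snd x))"
  have "open \<Omega>" unfolding \<Omega>_def by (intro open_Collect_neq continuous_intros)
  moreover have P: "path (\<lambda>t. (u t, v t))" unfolding path_def by (intro continuous_intros uv)
  moreover have "path_image (\<lambda>t. (u t, v t)) \<subseteq> \<Omega>"
    using uv(4) by (auto simp: path_image_def \<Omega>_def)
  ultimately obtain e where e: "e > 0" "\<And>h. path h \<Longrightarrow> pathstart h = (u 0, v 0) \<Longrightarrow> pathfinish h = (u 1, v 1) \<Longrightarrow>
      (\<And>t. t \<in> {0..1} \<Longrightarrow> norm (h t - (u t, v t)) < e) \<Longrightarrow> homotopic_paths \<Omega> (\<lambda>t. (u t, v t)) h"
    using homotopic_nearby_paths[of "\<lambda>t. (u t, v t)" \<Omega>] by (auto simp: pathstart_def pathfinish_def)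
  obtain q where q: "polynomial_function q" "pathstart q = (u 0, v 0)" "pathfinish q = (u 1, v 1)"
      "\<And>t. t \<in> {0..1} \<Longrightarrow> norm (q t - (u t, v t)) < e"
    using path_approx_polynomial_function[OF P e(1)] by (auto simp: pathstart_def pathfinish_def)
  have "homotopic_paths \<Omega> (\<lambda>t. (u t, v t)) q"
    using q by (intro e path_polynomial_function) auto
  then have "homotopic_paths F2T (E \<circ> (\<lambda>t. (u t, v t))) (E \<circ> q)"
    by (rule homotopic_paths_continuous_image)
       (auto simp: E_def \<Omega>_def wrap_pair_in_F2T intro!: continuous_intros)
  moreover have "homotopic_paths F2T p0 (E \<circ> (\<lambda>t. (u t, v t)))"
    using p0(1) uv(3) by (intro homotopic_paths_eq) (auto simp: loops_at_def E_def)
  ultimately have h: "homotopic_paths F2T p0 (E \<circ> q)"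
    using homotopic_paths_trans by blast
  have dq: "q differentiable_on {0..1}"
    using q(1) by (rule differentiable_on_polynomial_function)
  show ?thesis
  proof
    show "E \<circ> q \<in> loops_at F2T z"
      using p0(1) homotopic_paths_imp_path[OF h] homotopic_paths_imp_subset[OF h]
        homotopic_paths_imp_pathstart[OF h] homotopic_paths_imp_pathfinish[OF h]
      by (auto simp: loops_at_def)
    show "w = path_class F2T (E \<circ> q)" using p0(2) path_class_eq[OF h] by simp
    show "(\<lambda>t. fst (q t)) differentiable_on {0..1}" "(\<lambda>t. snd (q t)) differentiable_on {0..1}"
      using differentiable_on_compose[OF dq, of fst] differentiable_on_compose[OF dq, of snd]
      by (auto intro: bounded_linear_imp_differentiable_on bounded_linear_fst bounded_linear_snd)
    show "(E \<circ> q) t = (wrap (fst (q t)), wrap (snd (q t)))" for t by (simp add: E_def)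
  qed
qed

lemma wrap_eq_1D:
  assumes "wrap z = (1, 1)"
  obtains m n :: int where "z = Complex (2 * pi * m) (2 * pi * n)"
proof -
  have *: "\<exists>n::int. x = 2 * pi * n" if "cis x = 1" for x
  proof -
    have "cos x = 1" using that by (simp add: complex_eq_iff)
    then show ?thesis by (auto simp: cos_one_2pi_int mult_ac)
  qed
  obtain m n :: int where "Re z = 2 * pi * m" "Im z = 2 * pi * n"
    using assms *[of "Re z"] *[of "Im z"] by (auto simp: wrap_def)
  then show ?thesis
    using that by (simp add: complex_eq_iff)
qed

text \<open>The set is a countable union of translates of differentiable curves in the plane, one
for each index \<open>j\<close> and each period.\<close>

lemma negligible_wrapped_curves:
  fixes L :: "int \<Rightarrow> real \<Rightarrow> complex"
  assumes "\<And>j. L j differentiable_on {0..1}"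
  shows "negligible {\<kappa>. \<exists>t\<in>{0..1}. \<exists>j. wrap \<kappa> = wrap (L j t)}"
proof (rule negligible_subset)
  have "negligible ((\<lambda>t. L j t + Complex (2 * pi * m) (2 * pi * n)) ` {0..1})" for j and m n :: int
    using assms by (intro negligible_differentiable_image_lowdim differentiable_on_add) auto
  then show "negligible (\<Union>(j, m, n) \<in> (UNIV :: (int \<times> int \<times> int) set).
      (\<lambda>t. L j t + Complex (2 * pi * m) (2 * pi * n)) ` {0..1})"
    by (intro negligible_countable_Union) (auto simp: countable_image)
  show "{\<kappa>. \<exists>t\<in>{0..1}. \<exists>j. wrap \<kappa> = wrap (L j t)} \<subseteq> (\<Union>(j, m, n) \<in> (UNIV :: (int \<times> int \<times> int) set).
      (\<lambda>t. L j t + Complex (2 * pi * m) (2 * pi * n)) ` {0..1})"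
  proof safe
    fix \<kappa> t j assume t: "t \<in> {0..1::real}" "wrap \<kappa> = wrap (L j t)"
    then obtain m n :: int where "\<kappa> - L j t = Complex (2 * pi * m) (2 * pi * n)"
      using wrap_eq_1D wrap_eq_iff by metis
    then have "\<kappa> = L j t + Complex (2 * pi * m) (2 * pi * n)" by (simp add: algebra_simps)
    then show "\<kappa> \<in> (\<Union>(j, m, n) \<in> (UNIV :: (int \<times> int \<times> int) set).
      (\<lambda>t. L j t + Complex (2 * pi * m) (2 * pi * n)) ` {0..1})"
      using t(1) by (intro UN_I[of "(j, m, n)"]) auto
  qed
qed

section \<open>Two-valued maps from maps into the configuration space\<close>

lemma two_valued_map_of_pair:
  fixes F :: "'a::topological_space \<Rightarrow> 'b::t1_space \<times> 'b"
  assumes F: "continuous_on X F" "F \<in> X \<rightarrow> conf2 Y"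
  shows "two_valued_map X Y (\<lambda>x. {fst (F x), snd (F x)})"
proof -
  have FY: "fst (F x) \<in> Y" "snd (F x) \<in> Y" "fst (F x) \<noteq> snd (F x)" if "x \<in> X" for x
  proof -
    have "F x \<in> conf2 Y" using F(2) that by blast
    then show "fst (F x) \<in> Y" "snd (F x) \<in> Y" "fst (F x) \<noteq> snd (F x)" by (auto simp: conf2_def)
  qed
  have op: "openin (top_of_set X) (X \<inter> (\<lambda>x. fst (F x)) -` V)" "openin (top_of_set X) (X \<inter> (\<lambda>x. snd (F x)) -` V)"
    if "openin (top_of_set Y) V" for V
    using FY F(1) that by (auto intro!: continuous_openin_preimage[of X _ Y] continuous_intros)
  show ?thesis
    unfolding two_valued_map_def
  proof (intro conjI ballI allI impI)
    fix V assume V: "openin (top_of_set Y) V"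
    have "{x \<in> X. {fst (F x), snd (F x)} \<subseteq> V} = (X \<inter> (\<lambda>x. fst (F x)) -` V) \<inter> (X \<inter> (\<lambda>x. snd (F x)) -` V)"
      "{x \<in> X. {fst (F x), snd (F x)} \<inter> V \<noteq> {}} = (X \<inter> (\<lambda>x. fst (F x)) -` V) \<union> (X \<inter> (\<lambda>x. snd (F x)) -` V)"
      by auto
    then show "openin (top_of_set X) {x \<in> X. {fst (F x), snd (F x)} \<subseteq> V}"
      "openin (top_of_set X) {x \<in> X. {fst (F x), snd (F x)} \<inter> V \<noteq> {}}"
      using op[OF V] by (simp_all add: openin_Int openin_Un)
  qed (use FY in \<open>auto intro!: closed_subset\<close>)
qed

lemma deformable_of_homotopic_lifts:
  fixes f g :: "'a::topological_space \<Rightarrow> 'b::t1_space \<times> 'b"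
  assumes hom: "homotopic_with_canon (\<lambda>_. True) X (conf2 Y) f g"
    and \<phi>: "\<And>x. x \<in> X \<Longrightarrow> \<phi> x = {fst (f x), snd (f x)}"
  shows "deformable X Y \<phi> (\<lambda>x. {fst (g x), snd (g x)})"
proof -
  obtain h where h: "continuous_on ({0..1::real} \<times> X) h" "h ` ({0..1} \<times> X) \<subseteq> conf2 Y"
    "\<forall>x\<in>X. h (0, x) = f x" "\<forall>x\<in>X. h (1, x) = g x"
    using hom by (subst (asm) homotopic_with) (auto simp: image_subset_iff_funcset)
  have "two_valued_map (X \<times> {0..1}) Y (\<lambda>p. {fst (h (prod.swap p)), snd (h (prod.swap p))})"
  proof (rule two_valued_map_of_pair)
    show "continuous_on (X \<times> {0..1}) (\<lambda>p. h (prod.swap p))"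
      by (rule continuous_on_compose2[OF h(1)]) (auto intro!: continuous_on_swap)
    show "(\<lambda>p. h (prod.swap p)) \<in> X \<times> {0..1} \<rightarrow> conf2 Y"
      using h(2) by (force simp: image_subset_iff)
  qed
  then show ?thesis
    unfolding deformable_def using h(3,4) \<phi>
    by (intro exI[of _ "\<lambda>p. {fst (h (prod.swap p)), snd (h (prod.swap p))}"]) auto
qed

section \<open>Model maps on the torus and their fixed points\<close>

text \<open>The diagonal action of the torus on pairs of points; it preserves the configuration
space and its orbits along the two circle factors are the central loops.\<close>

definition shift :: "complex \<times> complex \<Rightarrow> torus_pair \<Rightarrow> torus_pair" where
  "shift \<tau> y = (torus_mult \<tau> (fst y), torus_mult \<tau> (snd y))"

lemma shift_in_F2T: "\<tau> \<in> torus \<Longrightarrow> y \<in> F2T \<Longrightarrow> shift \<tau> y \<in> F2T"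
  by (auto simp: shift_def conf2_def torus_mult_in_torus torus_mult_inject)

lemma continuous_on_shift [continuous_intros]:
  "continuous_on S f \<Longrightarrow> continuous_on S g \<Longrightarrow> continuous_on S (\<lambda>x. shift (f x) (g x))"
  unfolding shift_def torus_mult_def by (intro continuous_intros)

lemma shift_wrap: "shift (wrap x) (wrap u, wrap v) = (wrap (x + u), wrap (x + v))"
  by (simp add: shift_def wrap_add)

definition circle_map :: "(real \<Rightarrow> 'a) \<Rightarrow> complex \<Rightarrow> 'a" where
  "circle_map p \<zeta> = p (Arg2pi \<zeta> / (2 * pi))"

lemma circle_map_continuous:
  assumes "p \<in> loops_at S x"
  shows "continuous_on (sphere 0 1) (circle_map p)" "circle_map p \<in> sphere 0 1 \<rightarrow> S"
proof -
  have "homotopic_loops S p p" using assms by (auto simp: loops_at_def homotopic_loops_refl)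
  note h = homotopic_loops_imp_homotopic_circlemaps[OF this]
  show "continuous_on (sphere 0 1) (circle_map p)"
    using homotopic_with_imp_continuous[OF h] by (simp add: circle_map_def[abs_def] comp_def)
  show "circle_map p \<in> sphere 0 1 \<rightarrow> S"
    using homotopic_with_imp_funspace1[OF h] by (simp add: circle_map_def[abs_def] comp_def)
qed

lemma circle_map_cis: "circle_map p (cis (2 * pi * x)) = p (frac x)"
proof -
  have "Arg2pi (cis (2 * pi * x)) = 2 * pi * frac x"
  proof (rule Arg2pi_unique[of 1])
    have "cis (2 * pi * x) = cis (2 * pi * frac x + 2 * pi * of_int \<lfloor>x\<rfloor>)"
      by (simp add: frac_def algebra_simps)
    also have "\<dots> = cis (2 * pi * frac x)"
      by (simp flip: cis_mult)
    finally show "of_real 1 * exp (\<i> * complex_of_real (2 * pi * frac x)) = cis (2 * pi * x)"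
      by (simp add: cis_conv_exp)
    show "2 * pi * frac x < 2 * pi" using frac_lt_1[of x] by simp
  qed (auto simp: frac_ge_0)
  then show ?thesis by (simp add: circle_map_def)
qed

lemma loop_frac:
  assumes "p \<in> loops_at S x" "t \<in> {0..1}"
  shows "p (frac t) = p t"
proof (cases "t = 1")
  case True
  then show ?thesis using assms(1) by (auto simp: loops_at_def pathstart_def pathfinish_def)
next
  case False
  then have "frac t = t" using assms(2) by (simp add: frac_eq)
  then show ?thesis by simp
qed

text \<open>An explicit map with prescribed classes. In coordinates \<open>x, y\<close> with unit
period on the torus, centred at \<open>x0\<close>, it follows the loop \<open>p\<close> at time
\<open>r x + s y\<close> while the pair is moved rigidly by the vector
\<open>(a x + c y, b x + d y)\<close>.\<close>

definition model_map ::
  "(real \<Rightarrow> torus_pair) \<Rightarrow> complex \<times> complex \<Rightarrow> int \<Rightarrow> int \<Rightarrow> int \<Rightarrow> int \<Rightarrow> int \<Rightarrow> int \<Rightarrow>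
   complex \<times> complex \<Rightarrow> torus_pair" where
  "model_map p x0 r s a b c d z =
     (let u = fst z / fst x0; v = snd z / snd x0
      in shift (u powi a * v powi c, u powi b * v powi d) (circle_map p (u powi r * v powi s)))"

lemma model_map_continuous:
  assumes x0: "x0 \<in> torus" and p: "p \<in> loops_at F2T y"
  shows "continuous_on torus (model_map p x0 r s a b c d)" "model_map p x0 r s a b c d \<in> torus \<rightarrow> F2T"
proof -
  have n0: "norm (fst x0) = 1" "norm (snd x0) = 1" using x0 by (auto simp: torus_def)
  have n: "norm (fst z / fst x0) = 1" "norm (snd z / snd x0) = 1" if "z \<in> torus" for z
    using that n0 by (auto simp: torus_def norm_divide)
  have nn: "norm ((fst z / fst x0) powi i * (snd z / snd x0) powi j) = 1" if "z \<in> torus" for z i j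
    using n[OF that] by (simp add: norm_mult norm_power_int)
  have x00: "fst x0 \<noteq> 0" "snd x0 \<noteq> 0" using n0 by auto
  have nz: "fst z / fst x0 \<noteq> 0" "snd z / snd x0 \<noteq> 0" if "z \<in> torus" for z
    using n[OF that] by auto
  have mono: "continuous_on torus (\<lambda>z. (fst z / fst x0) powi i * (snd z / snd x0) powi j)" for i j
    using nz x00 by (intro continuous_intros) auto
  have "continuous_on torus (\<lambda>z. circle_map p ((fst z / fst x0) powi r * (snd z / snd x0) powi s))"
    by (rule continuous_on_compose2[OF circle_map_continuous(1)[OF p] mono]) (use nn in auto)
  then show "continuous_on torus (model_map p x0 r s a b c d)"
    unfolding model_map_def Let_def by (intro continuous_intros mono)
  show "model_map p x0 r s a b c d \<in> torus \<rightarrow> F2T"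
    unfolding model_map_def Let_def
  proof (intro Pi_I shift_in_F2T)
    fix z assume z: "z \<in> torus"
    show "((fst z / fst x0) powi a * (snd z / snd x0) powi c, (fst z / fst x0) powi b * (snd z / snd x0) powi d) \<in> torus"
      using nn[OF z] by (simp add: torus_def)
    show "circle_map p ((fst z / fst x0) powi r * (snd z / snd x0) powi s) \<in> F2T"
      using circle_map_continuous(2)[OF p] nn[OF z] by auto
  qed
qed

lemma model_map_eq:
  fixes x y :: real
  assumes x0: "x0 \<in> torus"
  shows "model_map p x0 r s a b c d (torus_mult (wrap (2 * pi * Complex x y)) x0) =
    shift (wrap (2 * pi * Complex (a * x + c * y) (b * x + d * y))) (p (frac (r * x + s * y)))"
proof -
  have x00: "fst x0 \<noteq> 0" "snd x0 \<noteq> 0" using x0 by (auto simp: torus_def)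
  have "cis (2 * pi * x) powi i * cis (2 * pi * y) powi j = cis (2 * pi * (i * x + j * y))" for i j
    by (simp add: cis_power_int cis_mult algebra_simps)
  then show ?thesis
    using x00 by (simp add: model_map_def torus_mult_def wrap_def circle_map_cis)
qed

text \<open>The map along meridian and longitude is a line in a family with three periodic
parameters: the time along \<open>p\<close> and the two components of the rigid motion. The three
unit vectors give the class of \<open>p\<close> and the two central elements.\<close>

lemma model_map_classes:
  assumes x0: "x0 \<in> torus" and p: "p \<in> loops_at F2T y"
  shows "path_class F2T (model_map p x0 r s a b c d \<circ> meridian x0) =
      braid y (path_class F2T p [^]\<^bsub>P2T y\<^esub> r, (a, b))"
    and "path_class F2T (model_map p x0 r s a b c d \<circ> longitude x0) =
      braid y (path_class F2T p [^]\<^bsub>P2T y\<^esub> s, (c, d))"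
proof -
  define \<Psi> where "\<Psi> \<equiv> \<lambda>v :: real \<times> real \<times> real.
    shift (wrap (2 * pi * Complex (fst (snd v)) (snd (snd v)))) (circle_map p (cis (2 * pi * fst v)))"
  have cont: "continuous_on UNIV \<Psi>"
    unfolding \<Psi>_def Complex_eq
    by (intro continuous_intros continuous_on_compose2[OF circle_map_continuous(1)[OF p]]) auto
  have "circle_map p (cis x) \<in> F2T" for x
    using circle_map_continuous(2)[OF p] by (rule funcset_mem) simp
  then have "\<Psi> v \<in> F2T" for v
    unfolding \<Psi>_def by (intro shift_in_F2T wrap_in_torus)
  then have ran: "range \<Psi> \<subseteq> F2T" by blast
  have p0: "p 0 = y" using p by (simp add: loops_at_def pathstart_def)
  have shift_1: "shift (1, 1) q = q" for q by (simp add: shift_def torus_mult_def)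
  have \<Psi>0: "\<Psi> 0 = y"
    by (simp add: \<Psi>_def circle_map_cis[of p 0, simplified] p0 wrap_def Complex_eq shift_1)
  have per: "\<Psi> (x + (1, 0, 0)) = \<Psi> x" "\<Psi> (x + (0, 1, 0)) = \<Psi> x" "\<Psi> (x + (0, 0, 1)) = \<Psi> x" for x
    by (simp_all add: \<Psi>_def wrap_def distrib_left flip: cis_mult)
  have "homotopic_paths F2T p (\<lambda>t. \<Psi> (t *\<^sub>R (1, 0, 0)))"
    using p loop_frac[OF p]
    by (intro homotopic_paths_eq) (auto simp: loops_at_def \<Psi>_def circle_map_cis wrap_def Complex_eq shift_1)
  then have cw: "line_class F2T \<Psi> (1, 0, 0) = path_class F2T p"
    unfolding line_class_def by (metis path_class_eq)
  have cx: "line_class F2T \<Psi> (0, 1, 0) = central_x y" and cy: "line_class F2T \<Psi> (0, 0, 1) = central_y y"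
    unfolding line_class_def central_x_def central_y_def
    by (simp_all add: \<Psi>_def circle_map_cis[of p 0, simplified] p0 wrap_def Complex_eq shift_def torus_mult_def
        meridian_def longitude_def)
  note pow = line_class_of_int[OF cont ran per(1)] line_class_of_int[OF cont ran per(2)]
    line_class_of_int[OF cont ran per(3)]
  have cls: "line_class F2T \<Psi> (of_int i, of_int j, of_int k) = braid y (path_class F2T p [^]\<^bsub>P2T y\<^esub> i, (j, k))" for i j k
  proof -
    have v: "(real_of_int i, real_of_int j, real_of_int k) =
      of_int i *\<^sub>R (1, 0, 0) + of_int j *\<^sub>R (0, 1, 0) + of_int k *\<^sub>R (0, 0, 1)"
      by simp
    have "\<Psi> (x + (of_int i *\<^sub>R (1, 0, 0) + of_int j *\<^sub>R (0, 1, 0))) = \<Psi> x" for x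
      using pow(1)[of i] pow(2)[of j] by (metis add.assoc)
    then show ?thesis
      unfolding v braid_def using pow(1)[of i] pow(2)[of j] pow(3)[of k]
      by (simp only: line_class_add[OF cont ran] \<Psi>0 cw cx cy prod.case)
  qed
  have "model_map p x0 r s a b c d (torus_mult (wrap (2 * pi * Complex t u)) x0) =
      \<Psi> (r * t + s * u, a * t + c * u, b * t + d * u)" for t u :: real
    unfolding model_map_eq[OF x0] by (simp add: \<Psi>_def circle_map_cis)
  moreover have "meridian x0 t = torus_mult (wrap (2 * pi * Complex t 0)) x0"
    "longitude x0 t = torus_mult (wrap (2 * pi * Complex 0 t)) x0" for t
    by (simp_all add: meridian_def longitude_def torus_mult_def wrap_def)
  ultimately have "model_map p x0 r s a b c d \<circ> meridian x0 = (\<lambda>t. \<Psi> (t *\<^sub>R (of_int r, of_int a, of_int b)))"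
    "model_map p x0 r s a b c d \<circ> longitude x0 = (\<lambda>t. \<Psi> (t *\<^sub>R (of_int s, of_int c, of_int d)))"
    by (auto simp: fun_eq_iff mult.commute)
  then show "path_class F2T (model_map p x0 r s a b c d \<circ> meridian x0) =
      braid y (path_class F2T p [^]\<^bsub>P2T y\<^esub> r, (a, b))"
    "path_class F2T (model_map p x0 r s a b c d \<circ> longitude x0) =
      braid y (path_class F2T p [^]\<^bsub>P2T y\<^esub> s, (c, d))"
    using cls by (simp_all add: line_class_def)
qed

lemma torus_coordinates:
  assumes "x0 \<in> torus" "z \<in> torus"
  obtains x y :: real where "z = torus_mult (wrap (2 * pi * Complex x y)) x0"
proof -
  have "norm (fst x0) = 1" "norm (snd x0) = 1" "norm (fst z) = 1" "norm (snd z) = 1"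
    using assms by (auto simp: torus_def)
  then obtain x y where "fst z = cis (2 * pi * x) * fst x0" "snd z = cis (2 * pi * y) * snd x0"
    using circle_quotient by metis
  then show ?thesis
    using that[of x y] by (simp add: torus_mult_def wrap_def prod_eq_iff)
qed

text \<open>Here the arithmetic condition enters. It says that the rigid motion relative to the
identity, \<open>((a - 1) x + c y, b x + (d - 1) y)\<close>, is a multiple
\<open>\<xi> (\<mu>, \<nu>)\<close> of the time \<open>\<xi> = r x + s y\<close> at which
\<open>p\<close> is evaluated. Hence the displacement of a point of the torus by either component
of the map depends on the single real parameter \<open>\<xi>\<close>. A rotation by
\<open>\<kappa>\<close> has a fixed point only if \<open>\<kappa>\<close> lies on one of countably
many differentiable curves, and these do not fill the plane.\<close>

lemma model_map_generic_shift:
  assumes x0: "x0 \<in> torus" and dir: "(r, s) \<noteq> (0, 0)" "s * (a - 1) = r * c" "s * b = r * (d - 1)"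
    and P: "P1 differentiable_on {0..1}" "P2 differentiable_on {0..1}"
      "\<And>t. t \<in> {0..1} \<Longrightarrow> p t = (wrap (P1 t), wrap (P2 t))"
  obtains \<kappa> where "\<And>z. z \<in> torus \<Longrightarrow> z \<noteq> fst (shift (wrap \<kappa>) (model_map p x0 r s a b c d z))"
    "\<And>z. z \<in> torus \<Longrightarrow> z \<noteq> snd (shift (wrap \<kappa>) (model_map p x0 r s a b c d z))"
proof -
  obtain \<mu> \<nu> :: real where \<mu>: "a - 1 = \<mu> * r" "c = \<mu> * s" and \<nu>: "b = \<nu> * r" "d - 1 = \<nu> * s"
  proof (cases "r = 0")
    case False
    have "real_of_int s * (a - 1) = r * c" "real_of_int s * b = r * (d - 1)"
      using dir(2,3) by (metis of_int_mult of_int_diff of_int_1)+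
    then show ?thesis
      using that[of "(a - 1) / r" "b / r"] False by (simp add: field_simps)
  next
    case True
    then show ?thesis
      using that[of "c / s" "(d - 1) / s"] dir by simp
  qed
  obtain \<theta> where \<theta>: "x0 = wrap \<theta>"
    using torus_coordinates[of "(1, 1)" x0] x0 by (metis (no_types) add.right_neutral wrap_0 wrap_add wrap_in_torus)
  \<comment> \<open>The time is \<open>\<xi> = j + t\<close> with integral part \<open>j\<close>; \<open>L P j t\<close> is the rotation that would create a fixed point there.\<close>
  define L where "L \<equiv> \<lambda>(P :: real \<Rightarrow> complex) (j::int) (t::real). \<theta> - of_real (2 * pi * (t + of_int j)) * Complex \<mu> \<nu> - P t"
  have "L P j differentiable_on {0..1}" if "P differentiable_on {0..1}" for P j
    unfolding L_def of_real_add of_real_mult using that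
    by (intro differentiable_on_diff differentiable_on_mult differentiable_on_add differentiable_on_const)
       (auto intro!: linear_imp_differentiable_on bounded_linear.linear bounded_linear_of_real)
  moreover define N where "N \<equiv> \<lambda>P. {\<kappa>. \<exists>t\<in>{0..1}. \<exists>j. wrap \<kappa> = wrap (L P j t)}"
  ultimately have "negligible (N P1 \<union> N P2)"
    unfolding N_def using P by (intro negligible_Un negligible_wrapped_curves)
  then have "N P1 \<union> N P2 \<noteq> UNIV"
    using non_negligible_UNIV by metis
  then obtain \<kappa> where "\<kappa> \<notin> N P1" "\<kappa> \<notin> N P2"
    by blast
  then have \<kappa>: "\<And>t j. t \<in> {0..1} \<Longrightarrow> wrap \<kappa> \<noteq> wrap (L P1 j t)" "\<And>t j. t \<in> {0..1} \<Longrightarrow> wrap \<kappa> \<noteq> wrap (L P2 j t)"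
    by (simp_all add: N_def)
  have "z \<noteq> fst (shift (wrap \<kappa>) (model_map p x0 r s a b c d z)) \<and>
    z \<noteq> snd (shift (wrap \<kappa>) (model_map p x0 r s a b c d z))" if z: "z \<in> torus" for z
  proof -
    obtain x y :: real where xy: "z = torus_mult (wrap (2 * pi * Complex x y)) x0"
      using torus_coordinates[OF x0 z] by blast
    define \<xi> where "\<xi> = r * x + s * y"
    define M where "M = 2 * pi * Complex (a * x + c * y) (b * x + d * y)"
    have fr: "frac \<xi> \<in> {0..1}" using frac_ge_0[of \<xi>] frac_lt_1[of \<xi>] by simp
    have val: "shift (wrap \<kappa>) (model_map p x0 r s a b c d z) =
        (wrap (\<kappa> + (M + P1 (frac \<xi>))), wrap (\<kappa> + (M + P2 (frac \<xi>))))"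
      unfolding xy model_map_eq[OF x0] \<xi>_def[symmetric] M_def[symmetric]
      using P(3)[OF fr] by (simp add: shift_wrap)
    have zz: "z = wrap (2 * pi * Complex x y + \<theta>)" by (simp add: xy \<theta> wrap_add)
    have M: "M = 2 * pi * Complex x y + 2 * pi * (frac \<xi> + of_int \<lfloor>\<xi>\<rfloor>) * Complex \<mu> \<nu>"
    proof -
      have "a * x + c * y = x + \<mu> * \<xi>" "b * x + d * y = y + \<nu> * \<xi>"
        unfolding \<xi>_def using \<mu> \<nu> by (auto simp: algebra_simps)
      moreover have "frac \<xi> + of_int \<lfloor>\<xi>\<rfloor> = \<xi>" by (simp add: frac_def)
      ultimately show ?thesis by (simp add: M_def complex_eq_iff algebra_simps)
    qed
    have "z \<noteq> wrap (\<kappa> + (M + P (frac \<xi>)))" if "\<And>t j. t \<in> {0..1} \<Longrightarrow> wrap \<kappa> \<noteq> wrap (L P j t)" for P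
    proof
      assume "z = wrap (\<kappa> + (M + P (frac \<xi>)))"
      then have "wrap (\<kappa> + (M + P (frac \<xi>)) - (2 * pi * Complex x y + \<theta>)) = (1, 1)"
        using zz wrap_eq_iff by metis
      moreover have "\<kappa> + (M + P (frac \<xi>)) - (2 * pi * Complex x y + \<theta>) = \<kappa> - L P \<lfloor>\<xi>\<rfloor> (frac \<xi>)"
        by (simp add: M L_def algebra_simps)
      ultimately show False
        using that[OF fr, of "\<lfloor>\<xi>\<rfloor>"] wrap_eq_iff by metis
    qed
    then show ?thesis
      unfolding val using \<kappa> by simp
  qed
  then show ?thesis using that by blast
qed

section \<open>Deformation to a fixed point free map\<close>

theorem theorem6:
  fixes \<phi> :: "complex \<times> complex \<Rightarrow> (complex \<times> complex) set"
    and \<Phi> :: "complex \<times> complex \<Rightarrow> (complex \<times> complex) \<times> (complex \<times> complex)"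
    and x0 :: "complex \<times> complex"
    and w :: "(real \<Rightarrow> (complex \<times> complex) \<times> (complex \<times> complex)) set"
    and a b c d r s :: int
  assumes "two_valued_map torus torus \<phi>" and "split_map torus torus \<phi>"
    and "is_lift torus torus \<phi> \<Phi>"
    and "x0 \<in> torus"
    and "w \<in> free_factor (\<Phi> x0)"
    and "pi1_map F2T \<Phi> (e1 x0) = braid (\<Phi> x0) (w [^]\<^bsub>P2T (\<Phi> x0)\<^esub> r, (a, b))"
    and "pi1_map F2T \<Phi> (e2 x0) = braid (\<Phi> x0) (w [^]\<^bsub>P2T (\<Phi> x0)\<^esub> s, (c, d))"
    and "(r, s) \<noteq> (0, 0)"
    and "(s * (a - 1), s * b) = (r * c, r * (d - 1))"
  shows "\<exists>\<psi>. two_valued_map torus torus \<psi> \<and> deformable torus torus \<phi> \<psi> \<and>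
    fixed_point_free torus \<psi>"
proof -
  have \<Phi>: "continuous_on torus \<Phi>" "\<Phi> \<in> torus \<rightarrow> F2T" "\<And>x. x \<in> torus \<Longrightarrow> \<phi> x = {fst (\<Phi> x), snd (\<Phi> x)}"
    using assms(3) by (auto simp: is_lift_def)
  have "w \<in> carrier (P2T (\<Phi> x0))" using assms(5) by (simp add: free_factor_def kernel_def)
  then obtain p P1 P2 where p: "p \<in> loops_at F2T (\<Phi> x0)" "w = path_class F2T p"
    and P: "P1 differentiable_on {0..1}" "P2 differentiable_on {0..1}"
      "\<And>t. t \<in> {0..1} \<Longrightarrow> p t = (wrap (P1 t), wrap (P2 t))"
    by (rule F2T_smooth_loop) blast
  define G where "G = model_map p x0 r s a b c d"
  note G = model_map_continuous[OF assms(4) p(1), where r=r and s=s and a=a and b=b and c=c and d=d, folded G_def]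
  note mer = loops_at_compose[OF \<Phi>(1,2) meridian_loop[OF assms(4)]]
    and lon = loops_at_compose[OF \<Phi>(1,2) longitude_loop[OF assms(4)]]
  have "path_class F2T (\<Phi> \<circ> meridian x0) = path_class F2T (G \<circ> meridian x0)"
    using assms(6) unfolding e1_def pi1_map_class[OF \<Phi>(1,2) meridian_loop[OF assms(4)]]
    by (simp add: G_def model_map_classes[OF assms(4) p(1)] p(2))
  then have "homotopic_paths F2T (\<Phi> \<circ> meridian x0) (G \<circ> meridian x0)"
    using path_class_eq_iff[OF mer] by simp
  moreover have "path_class F2T (\<Phi> \<circ> longitude x0) = path_class F2T (G \<circ> longitude x0)"
    using assms(7) unfolding e2_def pi1_map_class[OF \<Phi>(1,2) longitude_loop[OF assms(4)]]
    by (simp add: G_def model_map_classes[OF assms(4) p(1)] p(2))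
  then have "homotopic_paths F2T (\<Phi> \<circ> longitude x0) (G \<circ> longitude x0)"
    using path_class_eq_iff[OF lon] by simp
  ultimately have hom1: "homotopic_with_canon (\<lambda>_. True) torus F2T \<Phi> G"
    using F2T_cube_extension by (intro torus_maps_homotopic[OF _ \<Phi>(1,2) G assms(4)]) metis+
  obtain \<kappa> where \<kappa>: "\<And>z. z \<in> torus \<Longrightarrow> z \<noteq> fst (shift (wrap \<kappa>) (G z))"
    "\<And>z. z \<in> torus \<Longrightarrow> z \<noteq> snd (shift (wrap \<kappa>) (G z))"
    using model_map_generic_shift[OF assms(4,8) _ _ P, of a c b d] assms(9) unfolding G_def by auto
  define \<Phi>' where "\<Phi>' \<equiv> \<lambda>z. shift (wrap \<kappa>) (G z)"
  \<comment> \<open>The rotation by \<open>\<kappa>\<close> is switched on gradually.\<close>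
  have "homotopic_with_canon (\<lambda>_. True) torus F2T (\<lambda>z. shift (wrap (of_real 0 * \<kappa>)) (G z)) (\<lambda>z. shift (wrap (of_real 1 * \<kappa>)) (G z))"
    unfolding homotopic_with_def
  proof (intro exI[of _ "\<lambda>y. shift (wrap (of_real (fst y) * \<kappa>)) (G (snd y))"] conjI allI ballI TrueI)
    have "continuous_on ({0..1} \<times> torus) (\<lambda>y. shift (wrap (of_real (fst y) * \<kappa>)) (G (snd y)))"
      by (intro continuous_intros continuous_on_compose2[OF G(1)]) auto
    then show "continuous_map (prod_topology (top_of_set {0..1}) (top_of_set torus)) (top_of_set F2T)
        (\<lambda>y. shift (wrap (of_real (fst y) * \<kappa>)) (G (snd y)))"
      using G(2) by (auto simp: intro!: shift_in_F2T)
  qed auto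
  then have "homotopic_with_canon (\<lambda>_. True) torus F2T G \<Phi>'"
    by (simp add: \<Phi>'_def wrap_0 shift_def torus_mult_def)
  then have hom: "homotopic_with_canon (\<lambda>_. True) torus F2T \<Phi> \<Phi>'"
    using hom1 homotopic_with_trans by blast
  show ?thesis
  proof (intro exI conjI)
    show "two_valued_map torus torus (\<lambda>z. {fst (\<Phi>' z), snd (\<Phi>' z)})"
      using homotopic_with_imp_continuous[OF hom] homotopic_with_imp_funspace2[OF hom]
      by (intro two_valued_map_of_pair) auto
    show "deformable torus torus \<phi> (\<lambda>z. {fst (\<Phi>' z), snd (\<Phi>' z)})"
      using hom \<Phi>(3) by (rule deformable_of_homotopic_lifts)
    show "fixed_point_free torus (\<lambda>z. {fst (\<Phi>' z), snd (\<Phi>' z)})"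
      using \<kappa> by (auto simp: fixed_point_free_def \<Phi>'_def)
  qed
qed

end
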